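(* Let $H$ be a subgroup of a finite group $G$, let $G=\coprod_{i=1}^rg_iH$ with $g_1=1_G$, and let $(W,\rho)$ be a representation of $H$. Define the vector space $$\mathsf{PInd}_H^GW:=\bigoplus_{A\in\mathcal{P}_H(G/H)}\ \bigoplus_{g_iH\subseteq A}W^{A,i},$$ where the $W^{A,i}$ are vector spaces equipped with linear isomorphisms $\phi_{A,i}\colon W\to W^{A,i}$, and define $\widetilde\rho\colon G\to\operatorname{End}(\mathsf{PInd}_H^GW)$ by $$\widetilde\rho(g)(\phi_{A,i}(w)):=\begin{cases}0&\text{if }g^{-1}H\not\subseteq A,\\ \phi_{gA,j}(\rho(h)(w))&\text{if }g^{-1}H\subseteq A\text{ and }gg_i=g_jh\text{ with }h\in H,\end{cases}$$ for $g\in G$, $w\in W$, $A\in\mathcal{P}_H(G/H)$ and $g_iH\subseteq A$. Let $\eta_W\colon W\to\mathsf{PInd}_H^GW$, $\eta_W(w):=\sum_{A\in\mathcal{P}_H(G/H)}\phi_{A,1}(w)$. Then $(\mathsf{PInd}_H^GW,\widetilde\rho)$ is an $H$-global $G$-partial representation, $\eta_W$ is an $H$-homomorphism, and $(\mathsf{PInd}_H^GW,\widetilde\rho)$ together with $\eta_W$ is the partial induction of $W$ to $G$: for every $H$-global $G$-partial representation $U$ and every $H$-homomorphism $f\colon W\to\mathsf{Res}_H^GU$ there exists a unique morphism of $G$-partial representations $\tilde f\colon\mathsf{PInd}_H^GW\to U$ such that $\tilde f\circ\eta_W=f$. In particular (Frobenius reciprocity), $$\operatorname{Hom}_G(\m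athsf{PInd}_H^GW,U)\cong\operatorname{Hom}_H(W,\mathsf{Res}_H^GU).$$
   Context: All groups are finite and all vector spaces are finite-dimensional over $\mathbb{C}$. A $G$-partial representation $(V,\pi)$ is a map $\pi\colon G\to\operatorname{End}(V)$ such that for all $g,h\in G$: $\pi(1_G)=\mathrm{Id}_V$; $\pi(g^{-1})\pi(gh)=\pi(g^{-1})\pi(g)\pi(h)$; $\pi(gh)\pi(h^{-1})=\pi(g)\pi(h)\pi(h^{-1})$. It is $H$-global if the restriction of $\pi$ to $H$ is a (usual) representation of $H$; this representation of $H$ is denoted $\mathsf{Res}_H^GV$. A morphism $(V,\pi)\to(V',\pi')$ of $G$-partial representations is a linear map $f$ with $f\circ\pi(g)=\pi'(g)\circ f$ for all $g\in G$; $\operatorname{Hom}_G$ denotes the space of such morphisms. $\mathcal{P}_H(G/H):=\{A\subseteq G\mid H\subseteq A\text{ and }A\text{ is a union of left cosets of }H\}$. *)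

theory Defs
  imports Complex_Main "HOL-Algebra.Left_Coset" "HOL-Library.Function_Algebras"
begin

text \<open>
  A complex vector space is given by a scalar multiplication making a type a vector space and
  by a subspace of that type. Carriers are needed because the spaces
  \<open>pind_space\<close> and the Hom spaces are proper subspaces of types of functions. A linear map
  between two such spaces is represented by the unique function that agrees with it on its domain
  and vanishes elsewhere. Hence composition is \<open>(\<circ>)\<close>, equality of maps is equality of functions,
  and Hom spaces are subspaces of function types with pointwise operations.
\<close>

definition fd_space :: "(complex \<Rightarrow> 'v \<Rightarrow> 'v) \<Rightarrow> 'v::ab_group_add set \<Rightarrow> bool" where
  "fd_space s V \<longleftrightarrow> vector_space s \<and> module.subspace s V \<and>
     (\<exists>B. finite B \<and> B \<subseteq> V \<and> module.span s B = V)"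

definition fun_scale :: "(complex \<Rightarrow> 'v \<Rightarrow> 'v) \<Rightarrow> complex \<Rightarrow> ('k \<Rightarrow> 'v) \<Rightarrow> 'k \<Rightarrow> 'v" where
  "fun_scale s c x = (\<lambda>k. s c (x k))"

definition lin_maps :: "(complex \<Rightarrow> 'v \<Rightarrow> 'v) \<Rightarrow> 'v::ab_group_add set \<Rightarrow>
    (complex \<Rightarrow> 'u \<Rightarrow> 'u) \<Rightarrow> 'u::ab_group_add set \<Rightarrow> ('v \<Rightarrow> 'u) set" where
  "lin_maps sV V sU U = {f. (\<forall>v\<in>V. f v \<in> U) \<and>
     (\<forall>v\<in>V. \<forall>v'\<in>V. f (v + v') = f v + f v') \<and>
     (\<forall>c. \<forall>v\<in>V. f (sV c v) = sU c (f v)) \<and>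
     (\<forall>v. v \<notin> V \<longrightarrow> f v = 0)}"

definition lin_isos :: "(complex \<Rightarrow> 'v \<Rightarrow> 'v) \<Rightarrow> 'v::ab_group_add set \<Rightarrow>
    (complex \<Rightarrow> 'u \<Rightarrow> 'u) \<Rightarrow> 'u::ab_group_add set \<Rightarrow> ('v \<Rightarrow> 'u) set" where
  "lin_isos sV V sU U = {f \<in> lin_maps sV V sU U. bij_betw f V U}"

definition id_map :: "'v::zero set \<Rightarrow> 'v \<Rightarrow> 'v" where
  "id_map V = (\<lambda>v. if v \<in> V then v else 0)"

text \<open>
  The values of \<open>\<rho>\<close> and \<open>\<pi>\<close> outside the carrier of the group are irrelevant.
\<close>

definition representation :: "('g, 'm) monoid_scheme \<Rightarrow> (complex \<Rightarrow> 'v \<Rightarrow> 'v) \<Rightarrow>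
    'v::ab_group_add set \<Rightarrow> ('g \<Rightarrow> 'v \<Rightarrow> 'v) \<Rightarrow> bool" where
  "representation K s V \<rho> \<longleftrightarrow> fd_space s V \<and>
     (\<forall>g\<in>carrier K. \<rho> g \<in> lin_maps s V s V) \<and>
     \<rho> \<one>\<^bsub>K\<^esub> = id_map V \<and>
     (\<forall>g\<in>carrier K. \<forall>h\<in>carrier K. \<rho> (g \<otimes>\<^bsub>K\<^esub> h) = \<rho> g \<circ> \<rho> h)"

definition partial_rep :: "('g, 'm) monoid_scheme \<Rightarrow> (complex \<Rightarrow> 'v \<Rightarrow> 'v) \<Rightarrow>
    'v::ab_group_add set \<Rightarrow> ('g \<Rightarrow> 'v \<Rightarrow> 'v) \<Rightarrow> bool" where
  "partial_rep G s V \<pi> \<longleftrightarrow> fd_space s V \<and>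
     (\<forall>g\<in>carrier G. \<pi> g \<in> lin_maps s V s V) \<and>
     \<pi> \<one>\<^bsub>G\<^esub> = id_map V \<and>
     (\<forall>g\<in>carrier G. \<forall>h\<in>carrier G.
        \<pi> (inv\<^bsub>G\<^esub> g) \<circ> \<pi> (g \<otimes>\<^bsub>G\<^esub> h) = \<pi> (inv\<^bsub>G\<^esub> g) \<circ> \<pi> g \<circ> \<pi> h \<and>
        \<pi> (g \<otimes>\<^bsub>G\<^esub> h) \<circ> \<pi> (inv\<^bsub>G\<^esub> h) = \<pi> g \<circ> \<pi> h \<circ> \<pi> (inv\<^bsub>G\<^esub> h))"

definition global_partial_rep :: "('g, 'm) monoid_scheme \<Rightarrow> 'g set \<Rightarrow>
    (complex \<Rightarrow> 'v \<Rightarrow> 'v) \<Rightarrow> 'v::ab_group_add set \<Rightarrow> ('g \<Rightarrow> 'v \<Rightarrow> 'v) \<Rightarrow> bool" where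
  "global_partial_rep G H s V \<pi> \<longleftrightarrow>
     partial_rep G s V \<pi> \<and> representation (G\<lparr>carrier := H\<rparr>) s V \<pi>"

text \<open>
  The maps commuting with the action of a set \<open>X\<close> of group elements: \<open>X = carrier G\<close> gives the
  morphisms of \<open>G\<close>-partial representations, and \<open>X = H\<close> gives the \<open>H\<close>-homomorphisms, in which
  an \<open>H\<close>-global \<open>G\<close>-partial representation stands for its restriction to \<open>H\<close>.
\<close>

definition rep_hom :: "'g set \<Rightarrow> (complex \<Rightarrow> 'v \<Rightarrow> 'v) \<Rightarrow> 'v::ab_group_add set \<Rightarrow>
    ('g \<Rightarrow> 'v \<Rightarrow> 'v) \<Rightarrow> (complex \<Rightarrow> 'u \<Rightarrow> 'u) \<Rightarrow> 'u::ab_group_add set \<Rightarrow> ('g \<Rightarrow> 'u \<Rightarrow> 'u) \<Rightarrow>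
    ('v \<Rightarrow> 'u) set" where
  "rep_hom X sV V \<pi> sU U \<tau> = {f \<in> lin_maps sV V sU U. \<forall>g\<in>X. f \<circ> \<pi> g = \<tau> g \<circ> f}"

definition coset_unions :: "('g, 'm) monoid_scheme \<Rightarrow> 'g set \<Rightarrow> 'g set set" where
  "coset_unions G H = {A. A \<subseteq> carrier G \<and> H \<subseteq> A \<and> (\<exists>\<C>. \<C> \<subseteq> lcosets\<^bsub>G\<^esub> H \<and> A = \<Union>\<C>)}"

text \<open>\<open>G\<close> is the disjoint union of \<open>\<gamma> 1 H, \<dots>, \<gamma> r H\<close>, and \<open>\<gamma> 1\<close> is the identity.\<close>

definition coset_reps :: "('g, 'm) monoid_scheme \<Rightarrow> 'g set \<Rightarrow> nat \<Rightarrow> (nat \<Rightarrow> 'g) \<Rightarrow> bool" where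
  "coset_reps G H r \<gamma> \<longleftrightarrow> (\<forall>i\<in>{1..r}. \<gamma> i \<in> carrier G) \<and>
     (\<Union>i\<in>{1..r}. \<gamma> i <#\<^bsub>G\<^esub> H) = carrier G \<and>
     (\<forall>i\<in>{1..r}. \<forall>j\<in>{1..r}. i \<noteq> j \<longrightarrow> (\<gamma> i <#\<^bsub>G\<^esub> H) \<inter> (\<gamma> j <#\<^bsub>G\<^esub> H) = {}) \<and>
     \<gamma> 1 = \<one>\<^bsub>G\<^esub>"

definition coset_index :: "('g, 'm) monoid_scheme \<Rightarrow> 'g set \<Rightarrow> nat \<Rightarrow> (nat \<Rightarrow> 'g) \<Rightarrow> 'g \<Rightarrow> nat" where
  "coset_index G H r \<gamma> x = (THE j. j \<in> {1..r} \<and> x \<in> \<gamma> j <#\<^bsub>G\<^esub> H)"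

definition pind_index :: "('g, 'm) monoid_scheme \<Rightarrow> 'g set \<Rightarrow> nat \<Rightarrow> (nat \<Rightarrow> 'g) \<Rightarrow>
    ('g set \<times> nat) set" where
  "pind_index G H r \<gamma> = {(A, i). A \<in> coset_unions G H \<and> i \<in> {1..r} \<and> \<gamma> i <#\<^bsub>G\<^esub> H \<subseteq> A}"

text \<open>
  The external direct sum of the spaces \<open>S A i\<close>; the index set is finite when \<open>G\<close> is, so no
  finiteness of supports has to be imposed.
\<close>

definition pind_space :: "('g, 'm) monoid_scheme \<Rightarrow> 'g set \<Rightarrow> nat \<Rightarrow> (nat \<Rightarrow> 'g) \<Rightarrow>
    ('g set \<Rightarrow> nat \<Rightarrow> 'x::zero set) \<Rightarrow> ('g set \<times> nat \<Rightarrow> 'x) set" where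
  "pind_space G H r \<gamma> S = {x. (\<forall>(A, i)\<in>pind_index G H r \<gamma>. x (A, i) \<in> S A i) \<and>
     (\<forall>k. k \<notin> pind_index G H r \<gamma> \<longrightarrow> x k = 0)}"

definition pind_incl :: "('g set \<Rightarrow> nat \<Rightarrow> 'w \<Rightarrow> 'x::zero) \<Rightarrow> 'g set \<Rightarrow> nat \<Rightarrow> 'w \<Rightarrow>
    'g set \<times> nat \<Rightarrow> 'x" where
  "pind_incl \<phi> A i w = (\<lambda>k. if k = (A, i) then \<phi> A i w else 0)"

text \<open>
  The action on the summands, and its linear extension to the direct sum. An element \<open>x\<close> of the
  direct sum is the sum over \<open>(A, i)\<close> of \<open>pind_incl \<phi> A i w\<close> with \<open>\<phi> A i w = x (A, i)\<close>. The
  lemma \<open>pind_rep_incl\<close> below shows that \<open>pind_rep\<close> has the prescribed values.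
\<close>

definition pind_rep_gen :: "('g, 'm) monoid_scheme \<Rightarrow> 'g set \<Rightarrow> nat \<Rightarrow> (nat \<Rightarrow> 'g) \<Rightarrow>
    ('g \<Rightarrow> 'w \<Rightarrow> 'w) \<Rightarrow> ('g set \<Rightarrow> nat \<Rightarrow> 'w \<Rightarrow> 'x::ab_group_add) \<Rightarrow>
    'g \<Rightarrow> 'g set \<Rightarrow> nat \<Rightarrow> 'w \<Rightarrow> 'g set \<times> nat \<Rightarrow> 'x" where
  "pind_rep_gen G H r \<gamma> \<rho> \<phi> g A i w =
     (if inv\<^bsub>G\<^esub> g <#\<^bsub>G\<^esub> H \<subseteq> A then
        let j = coset_index G H r \<gamma> (g \<otimes>\<^bsub>G\<^esub> \<gamma> i);
            h = inv\<^bsub>G\<^esub> (\<gamma> j) \<otimes>\<^bsub>G\<^esub> (g \<otimes>\<^bsub>G\<^esub> \<gamma> i)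
        in pind_incl \<phi> (g <#\<^bsub>G\<^esub> A) j (\<rho> h w)
      else 0)"

definition pind_rep :: "('g, 'm) monoid_scheme \<Rightarrow> 'g set \<Rightarrow> nat \<Rightarrow> (nat \<Rightarrow> 'g) \<Rightarrow>
    'w set \<Rightarrow> ('g \<Rightarrow> 'w \<Rightarrow> 'w) \<Rightarrow> ('g set \<Rightarrow> nat \<Rightarrow> 'x set) \<Rightarrow>
    ('g set \<Rightarrow> nat \<Rightarrow> 'w \<Rightarrow> 'x::ab_group_add) \<Rightarrow> 'g \<Rightarrow>
    ('g set \<times> nat \<Rightarrow> 'x) \<Rightarrow> 'g set \<times> nat \<Rightarrow> 'x" where
  "pind_rep G H r \<gamma> W \<rho> S \<phi> g x =
     (if x \<in> pind_space G H r \<gamma> S then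
        \<Sum>(A, i)\<in>pind_index G H r \<gamma>.
          pind_rep_gen G H r \<gamma> \<rho> \<phi> g A i (inv_into W (\<phi> A i) (x (A, i)))
      else 0)"

definition pind_unit :: "('g, 'm) monoid_scheme \<Rightarrow> 'g set \<Rightarrow>
    ('g set \<Rightarrow> nat \<Rightarrow> 'w \<Rightarrow> 'x::ab_group_add) \<Rightarrow> 'w \<Rightarrow> 'g set \<times> nat \<Rightarrow> 'x" where
  "pind_unit G H \<phi> w = (\<Sum>A\<in>coset_unions G H. pind_incl \<phi> A 1 w)"

lemma coset_index_eq:
  assumes "coset_reps G H r \<gamma>" and "j \<in> {1..r}" and "x \<in> \<gamma> j <#\<^bsub>G\<^esub> H"
  shows "coset_index G H r \<gamma> x = j"
  unfolding coset_index_def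
proof (rule the_equality)
  show "j' = j" if "j' \<in> {1..r} \<and> x \<in> \<gamma> j' <#\<^bsub>G\<^esub> H" for j'
    using assms that unfolding coset_reps_def by blast
qed (use assms in blast)

lemma finite_pind_index:
  assumes "finite (carrier G)"
  shows "finite (pind_index G H r \<gamma>)"
proof (rule finite_subset)
  show "pind_index G H r \<gamma> \<subseteq> Pow (carrier G) \<times> {1..r}"
    by (auto simp: pind_index_def coset_unions_def)
qed (use assms in auto)

lemma zero_lin_map:
  assumes "fd_space sV V" and "fd_space sU U" and "f \<in> lin_maps sV V sU U"
  shows "0 \<in> V" and "f 0 = 0"
proof -
  interpret V: vector_space sV using assms(1) by (simp add: fd_space_def)
  show z: "0 \<in> V" using assms(1) by (simp add: fd_space_def V.subspace_0)
  have "f (0 + 0) = f 0 + f 0" using assms(3) z unfolding lin_maps_def by blast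
  then show "f 0 = 0" by simp
qed

lemma coset_index_decomp:
  fixes G (structure)
  assumes G: "group G" and H: "subgroup H G" and \<gamma>: "coset_reps G H r \<gamma>"
    and x: "x \<in> carrier G"
  obtains j h where "j \<in> {1..r}" and "h \<in> H" and "x = \<gamma> j \<otimes> h"
  using \<gamma> x unfolding coset_reps_def l_coset_def by blast

lemma coset_index_mult:
  fixes G (structure)
  assumes G: "group G" and H: "subgroup H G" and \<gamma>: "coset_reps G H r \<gamma>"
    and j: "j \<in> {1..r}" and h: "h \<in> H"
  shows "coset_index G H r \<gamma> (\<gamma> j \<otimes> h) = j" and "inv (\<gamma> j) \<otimes> (\<gamma> j \<otimes> h) = h"
proof -
  interpret group G by fact
  show "coset_index G H r \<gamma> (\<gamma> j \<otimes> h) = j"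
    using h by (intro coset_index_eq[OF \<gamma> j]) (auto simp: l_coset_def)
  have "\<gamma> j \<in> carrier G" and "h \<in> carrier G"
    using \<gamma> j h subgroup.subset[OF H] unfolding coset_reps_def by blast+
  then show "inv (\<gamma> j) \<otimes> (\<gamma> j \<otimes> h) = h" by (simp add: m_assoc[symmetric])
qed

lemma coset_unions_closed:
  fixes G (structure)
  assumes G: "group G" and H: "subgroup H G" and A: "A \<in> coset_unions G H"
    and a: "a \<in> A" and h: "h \<in> H"
  shows "a \<otimes> h \<in> A"
proof -
  interpret group G by fact
  obtain c where c: "c \<in> carrier G" "a \<in> c <# H" "c <# H \<subseteq> A"
    using A a unfolding coset_unions_def LCOSETS_def by blast
  then obtain k where k: "k \<in> H" "a = c \<otimes> k" by (auto simp: l_coset_def)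
  have "a \<otimes> h = c \<otimes> (k \<otimes> h)"
    using c k h subgroup.subset[OF H] by (auto intro: m_assoc)
  then have "a \<otimes> h \<in> c <# H"
    using subgroup.m_closed[OF H k(1) h] by (auto simp: l_coset_def)
  then show ?thesis using c by blast
qed

lemma coset_unions_l_coset:
  fixes G (structure)
  assumes G: "group G" and H: "subgroup H G" and A: "A \<in> coset_unions G H"
    and g: "g \<in> carrier G" and gA: "inv g <# H \<subseteq> A"
  shows "g <# A \<in> coset_unions G H"
proof -
  interpret group G by fact
  have sub: "A \<subseteq> carrier G" and HG: "H \<subseteq> carrier G"
    using A subgroup.subset[OF H] by (auto simp: coset_unions_def)
  have 1: "g <# A \<subseteq> carrier G" using l_coset_subset_G[OF sub g] .
  have 2: "H \<subseteq> g <# A"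
  proof
    fix h assume h: "h \<in> H"
    then have "inv g \<otimes> h \<in> A" using gA by (auto simp: l_coset_def)
    moreover have "h = g \<otimes> (inv g \<otimes> h)" using g h HG by (auto simp: m_assoc[symmetric])
    ultimately show "h \<in> g <# A" unfolding l_coset_def by blast
  qed
  have 3: "g <# A = \<Union>((\<lambda>b. b <# H) ` (g <# A))"
  proof
    show "g <# A \<subseteq> \<Union>((\<lambda>b. b <# H) ` (g <# A))" using lcos_self[OF _ H] 1 by blast
    show "\<Union>((\<lambda>b. b <# H) ` (g <# A)) \<subseteq> g <# A"
    proof
      fix y assume "y \<in> \<Union>((\<lambda>b. b <# H) ` (g <# A))"
      then obtain a h where ah: "a \<in> A" "h \<in> H" "y = g \<otimes> a \<otimes> h" by (auto simp: l_coset_def)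
      then have "y = g \<otimes> (a \<otimes> h)" using g sub HG by (auto intro: m_assoc)
      then show "y \<in> g <# A"
        using coset_unions_closed[OF G H A ah(1,2)] by (auto simp: l_coset_def)
    qed
  qed
  have 4: "(\<lambda>b. b <# H) ` (g <# A) \<subseteq> lcosets H" using 1 by (auto simp: LCOSETS_def)
  show ?thesis using 1 2 3 4 unfolding coset_unions_def by blast
qed

lemma pind_index_l_coset:
  fixes G (structure)
  assumes G: "group G" and H: "subgroup H G" and \<gamma>: "coset_reps G H r \<gamma>"
    and k: "(A, i) \<in> pind_index G H r \<gamma>" and g: "g \<in> carrier G" and gA: "inv g <# H \<subseteq> A"
    and j: "j \<in> {1..r}" and h: "h \<in> H" and eq: "g \<otimes> \<gamma> i = \<gamma> j \<otimes> h"
  shows "(g <# A, j) \<in> pind_index G H r \<gamma>"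
proof -
  interpret group G by fact
  have A: "A \<in> coset_unions G H" and i: "i \<in> {1..r}" and iA: "\<gamma> i <# H \<subseteq> A"
    using k by (auto simp: pind_index_def)
  have c: "\<gamma> i \<in> carrier G" "\<gamma> j \<in> carrier G" "h \<in> carrier G"
    using \<gamma> i j h subgroup.subset[OF H] unfolding coset_reps_def by blast+
  have "\<gamma> j <# H \<subseteq> g <# A"
  proof
    fix y assume "y \<in> \<gamma> j <# H"
    then obtain h' where h': "h' \<in> H" "y = \<gamma> j \<otimes> h'" by (auto simp: l_coset_def)
    have h'c: "h' \<in> carrier G" using h' subgroup.subset[OF H] by auto
    have "\<gamma> j = g \<otimes> \<gamma> i \<otimes> inv h" using eq c by (simp add: m_assoc)
    then have "y = g \<otimes> (\<gamma> i \<otimes> (inv h \<otimes> h'))" using h' h'c c g by (simp add: m_assoc)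
    moreover have "\<gamma> i \<otimes> (inv h \<otimes> h') \<in> A"
      using iA subgroup.m_closed[OF H subgroup.m_inv_closed[OF H h] h'(1)]
      by (auto simp: l_coset_def)
    ultimately show "y \<in> g <# A" unfolding l_coset_def by blast
  qed
  then show ?thesis
    using coset_unions_l_coset[OF G H A g gA] j by (auto simp: pind_index_def)
qed

lemma pind_rep_incl:
  fixes G (structure)
  assumes G: "group G" "finite (carrier G)" and H: "subgroup H G"
    and \<gamma>: "coset_reps G H r \<gamma>"
    and \<rho>: "representation (G\<lparr>carrier := H\<rparr>) sW W \<rho>"
    and S: "\<And>A i. (A, i) \<in> pind_index G H r \<gamma> \<Longrightarrow> fd_space sX (S A i)"
    and \<phi>: "\<And>A i. (A, i) \<in> pind_index G H r \<gamma> \<Longrightarrow> \<phi> A i \<in> lin_isos sW W sX (S A i)"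
    and g: "g \<in> carrier G" and w: "w \<in> W" and k: "(A, i) \<in> pind_index G H r \<gamma>"
  shows "\<not> inv\<^bsub>G\<^esub> g <#\<^bsub>G\<^esub> H \<subseteq> A \<Longrightarrow> pind_rep G H r \<gamma> W \<rho> S \<phi> g (pind_incl \<phi> A i w) = 0"
    and "\<lbrakk>inv\<^bsub>G\<^esub> g <#\<^bsub>G\<^esub> H \<subseteq> A; j \<in> {1..r}; h \<in> H; g \<otimes>\<^bsub>G\<^esub> \<gamma> i = \<gamma> j \<otimes>\<^bsub>G\<^esub> h\<rbrakk> \<Longrightarrow>
      pind_rep G H r \<gamma> W \<rho> S \<phi> g (pind_incl \<phi> A i w) = pind_incl \<phi> (g <#\<^bsub>G\<^esub> A) j (\<rho> h w)"
proof -
  interpret group G by fact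
  let ?I = "pind_index G H r \<gamma>"
  let ?x = "pind_incl \<phi> A i w"
  have W: "fd_space sW W" using \<rho> by (simp add: representation_def)
  have "0 \<in> S B l" if "(B, l) \<in> ?I" for B l
    using zero_lin_map(2)[OF W S[OF that], of "\<phi> B l"] zero_lin_map(1)[OF W S[OF that], of "\<phi> B l"]
      \<phi>[OF that] by (auto simp: lin_isos_def lin_maps_def)
  then have x: "?x \<in> pind_space G H r \<gamma> S"
    using \<phi>[OF k] k w by (auto simp: pind_space_def pind_incl_def lin_isos_def lin_maps_def)
  have inv0: "inv_into W (\<phi> B l) (?x (B, l)) = (if (B, l) = (A, i) then w else 0)"
    if "(B, l) \<in> ?I" for B l
  proof -
    have inj: "inj_on (\<phi> B l) W" using \<phi>[OF that] by (auto simp: lin_isos_def bij_betw_def)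
    have z: "0 \<in> W" "\<phi> B l 0 = 0"
      using zero_lin_map[OF W S[OF that], of "\<phi> B l"] \<phi>[OF that] by (auto simp: lin_isos_def)
    show ?thesis
      using inv_into_f_f[OF inj w] inv_into_f_f[OF inj z(1)] z(2) by (auto simp: pind_incl_def)
  qed
  have gen0: "pind_rep_gen G H r \<gamma> \<rho> \<phi> g B l 0 = 0" if Bl: "(B, l) \<in> ?I" for B l
  proof (cases "inv g <# H \<subseteq> B")
    case True
    have "\<gamma> l \<in> carrier G" using Bl \<gamma> by (auto simp: pind_index_def coset_reps_def)
    then have "g \<otimes> \<gamma> l \<in> carrier G" using g by simp
    then obtain j h where jh: "j \<in> {1..r}" "h \<in> H" "g \<otimes> \<gamma> l = \<gamma> j \<otimes> h"
      by (rule coset_index_decomp[OF G(1) H \<gamma>])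
    have gB: "(g <# B, j) \<in> ?I" by (rule pind_index_l_coset[OF G(1) H \<gamma> Bl g True jh])
    have "\<rho> h 0 = 0"
      using zero_lin_map(2)[OF W W, of "\<rho> h"] \<rho> jh by (auto simp: representation_def)
    moreover have "\<phi> (g <# B) j 0 = 0"
      using zero_lin_map(2)[OF W S[OF gB], of "\<phi> (g <# B) j"] \<phi>[OF gB] by (auto simp: lin_isos_def)
    ultimately show ?thesis
      using coset_index_mult[OF G(1) H \<gamma> jh(1,2)]
      by (auto simp: pind_rep_gen_def Let_def pind_incl_def jh(3) fun_eq_iff)
  qed (simp add: pind_rep_gen_def)
  have "pind_rep G H r \<gamma> W \<rho> S \<phi> g ?x =
      (\<Sum>k\<in>?I. if k = (A, i) then pind_rep_gen G H r \<gamma> \<rho> \<phi> g A i w else 0)"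
    unfolding pind_rep_def using x inv0 gen0
    by (simp add: split_def) (rule sum.cong, auto)
  also have "\<dots> = pind_rep_gen G H r \<gamma> \<rho> \<phi> g A i w"
    using finite_pind_index[OF G(2), of H r \<gamma>] k by simp
  finally have main: "pind_rep G H r \<gamma> W \<rho> S \<phi> g ?x = pind_rep_gen G H r \<gamma> \<rho> \<phi> g A i w" .
  show "\<not> inv g <# H \<subseteq> A \<Longrightarrow> pind_rep G H r \<gamma> W \<rho> S \<phi> g ?x = 0"
    by (simp add: main pind_rep_gen_def)
  assume *: "inv g <# H \<subseteq> A" "j \<in> {1..r}" "h \<in> H" "g \<otimes> \<gamma> i = \<gamma> j \<otimes> h"
  show "pind_rep G H r \<gamma> W \<rho> S \<phi> g ?x = pind_incl \<phi> (g <# A) j (\<rho> h w)"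
    using * coset_index_mult[OF G(1) H \<gamma> *(2,3)] by (simp add: main pind_rep_gen_def Let_def)
qed

end

(*
  In a partial representation tau of G the operators e_g = tau(g) tau(g^-1) are commuting
  idempotents with tau(h) e_g = e_{hg} tau(h), and e_{gh} = e_g for h in H if tau is H-global. So
  every vector u is uniquely the sum of simultaneous eigenvectors u_A, where e_g acts on u_A as 1 if
  g is in A and as 0 otherwise, and u_A = 0 unless A is a union of left cosets containing H.
  In PInd the element phi_{A,1}(w) is the A-component of eta(w), and
  phi_{A,i}(w) = rho~(g_i) phi_{g_i^-1 A, 1}(w). A morphism F with F o eta = f preserves components,
  so it has to send phi_{A,i}(w) to tau(g_i) applied to the (g_i^-1 A)-component of f(w); this
  formula does define a morphism.
*)
theory Submission
  imports Defs
begin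

section \<open>Simultaneous eigenvectors of commuting idempotents\<close>

text \<open>The set \<open>A\<close> attached to an eigenvector records where a partial
  representation is multiplicative. For \<open>v\<close> in \<open>eigen A\<close>,
  \<open>\<tau> x v = 0\<close> if \<open>inv x\<close> is not in \<open>A\<close>, and
  \<open>\<tau> g (\<tau> x v) = \<tau> (g \<otimes> x) v\<close> if it is. This explains the
  condition on the inverse coset in the definition of the induced action, and it is why the formula
  for the morphism is compatible with every \<open>g\<close>: both sides obey the same rule. The
  remaining obstacle is the choice of coset representatives, which enters both the action and the
  formula. It is removed by \<open>vec A x w\<close>, defined for every \<open>x\<close> in
  \<open>A\<close>: the action becomes left translation of both labels, and the morphism becomes
  \<open>\<tau> x\<close> applied to the component of \<open>f w\<close> at
  \<open>inv x <# A\<close>. The price is compatibility with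
  \<open>vec A (x \<otimes> h) w = vec A x (\<rho> h w)\<close>, which holds because
  \<open>f\<close> is an \<open>H\<close>-homomorphism and \<open>H\<close> permutes components by
  translation.\<close>

text \<open>The product of all \<open>e g\<close> with \<open>g\<close> in \<open>A\<close> and all
  \<open>1 - e g\<close> with \<open>g\<close> outside \<open>A\<close>, where \<open>g\<close> runs
  through the list; the head of the list is applied last.\<close>

primrec spectral_proj :: "('g \<Rightarrow> 'u \<Rightarrow> 'u) \<Rightarrow> 'g list \<Rightarrow> 'g set \<Rightarrow> 'u::ab_group_add \<Rightarrow> 'u" where
  "spectral_proj e [] A u = u"
| "spectral_proj e (g # gs) A u =
    (let v = spectral_proj e gs A u in if g \<in> A then e g v else v - e g v)"

locale commuting_idempotents =
  fixes X :: "'g set" and sU :: "complex \<Rightarrow> 'u::ab_group_add \<Rightarrow> 'u" and U :: "'u set"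
    and e :: "'g \<Rightarrow> 'u \<Rightarrow> 'u"
  assumes finite_X: "finite X"
    and U: "fd_space sU U"
    and e: "g \<in> X \<Longrightarrow> e g \<in> lin_maps sU U sU U"
    and idem: "g \<in> X \<Longrightarrow> e g (e g u) = e g u"
    and comm: "g \<in> X \<Longrightarrow> h \<in> X \<Longrightarrow> e g (e h u) = e h (e g u)"
begin

sublocale U: vector_space sU
  using U by (simp add: fd_space_def)

lemma U_closed:
  "0 \<in> U" "u \<in> U \<Longrightarrow> v \<in> U \<Longrightarrow> u + v \<in> U"
  "u \<in> U \<Longrightarrow> v \<in> U \<Longrightarrow> u - v \<in> U" "u \<in> U \<Longrightarrow> sU c u \<in> U"
  using U by (simp_all add: fd_space_def U.subspace_0 U.subspace_add U.subspace_diff U.subspace_scale)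

lemma e_closed: "g \<in> X \<Longrightarrow> u \<in> U \<Longrightarrow> e g u \<in> U"
  and e_add: "g \<in> X \<Longrightarrow> u \<in> U \<Longrightarrow> v \<in> U \<Longrightarrow> e g (u + v) = e g u + e g v"
  and e_scale: "g \<in> X \<Longrightarrow> u \<in> U \<Longrightarrow> e g (sU c u) = sU c (e g u)"
  using e unfolding lin_maps_def by blast+

lemma e_zero: "g \<in> X \<Longrightarrow> e g 0 = 0"
  using e_add[of g 0 0] U_closed by simp

lemma e_diff: "g \<in> X \<Longrightarrow> u \<in> U \<Longrightarrow> v \<in> U \<Longrightarrow> e g (u - v) = e g u - e g v"
  using e_add[of g "u - v" v] U_closed by simp

definition eigen :: "'g set \<Rightarrow> 'u set" where
  "eigen A = {u \<in> U. \<forall>g\<in>X. e g u = (if g \<in> A then u else 0)}"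

lemma spectral_proj_closed: "set gs \<subseteq> X \<Longrightarrow> u \<in> U \<Longrightarrow> spectral_proj e gs A u \<in> U"
  by (induction gs) (auto simp: Let_def e_closed U_closed)

lemma spectral_proj_add:
  "set gs \<subseteq> X \<Longrightarrow> u \<in> U \<Longrightarrow> v \<in> U \<Longrightarrow>
    spectral_proj e gs A (u + v) = spectral_proj e gs A u + spectral_proj e gs A v"
  by (induction gs) (auto simp: Let_def e_add spectral_proj_closed)

lemma spectral_proj_zero: "set gs \<subseteq> X \<Longrightarrow> spectral_proj e gs A 0 = 0"
  by (induction gs) (auto simp: Let_def e_zero)

lemma spectral_proj_scale:
  "set gs \<subseteq> X \<Longrightarrow> u \<in> U \<Longrightarrow> spectral_proj e gs A (sU c u) = sU c (spectral_proj e gs A u)"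
  by (induction gs) (auto simp: Let_def e_scale spectral_proj_closed U.scale_right_diff_distrib)

text \<open>The operator \<open>e g\<close> fixes the image of \<open>e g\<close>, kills the image
  of \<open>1 - e g\<close>, and commutes with every factor applied later.\<close>

lemma spectral_proj_eigen:
  "set gs \<subseteq> X \<Longrightarrow> u \<in> U \<Longrightarrow> g \<in> set gs \<Longrightarrow>
    e g (spectral_proj e gs A u) = (if g \<in> A then spectral_proj e gs A u else 0)"
proof (induction gs)
  case (Cons h gs)
  let ?v = "spectral_proj e gs A u"
  have v: "?v \<in> U" and hX: "h \<in> X" and gX: "g \<in> X"
    using Cons.prems by (auto intro: spectral_proj_closed)
  show ?case
  proof (cases "g = h")
    case True
    then show ?thesis using v hX by (auto simp: Let_def idem e_diff e_closed)
  next
    case False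
    then have "e g ?v = (if g \<in> A then ?v else 0)" using Cons by auto
    then show ?thesis
      using v hX gX by (auto simp: Let_def comm[OF gX hX] e_diff e_closed e_zero)
  qed
qed simp

lemma spectral_proj_insert:
  "g \<notin> set gs \<Longrightarrow> spectral_proj e gs (insert g A) u = spectral_proj e gs A u"
  by (induction gs) (auto simp: Let_def)

text \<open>This expands the identity as a product of factors \<open>e g + (1 - e g)\<close>; a
  subset of the list says which of the two terms is taken in each factor.\<close>

lemma spectral_proj_sum:
  "set gs \<subseteq> X \<Longrightarrow> distinct gs \<Longrightarrow> (\<Sum>A\<in>Pow (set gs). spectral_proj e gs A u) = u"
proof (induction gs)
  case (Cons g gs)
  let ?p = "\<lambda>A. spectral_proj e gs A u"
  have g: "g \<notin> set gs" using Cons.prems by simp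
  have inj: "inj_on (insert g) (Pow (set gs))"
    using g by (auto simp: inj_on_def)
  have disj: "Pow (set gs) \<inter> insert g ` Pow (set gs) = {}" using g by auto
  have "(\<Sum>A\<in>Pow (set (g # gs)). spectral_proj e (g # gs) A u) =
      (\<Sum>A\<in>Pow (set gs). spectral_proj e (g # gs) A u) +
      (\<Sum>A\<in>Pow (set gs). spectral_proj e (g # gs) (insert g A) u)"
    unfolding list.set(2) Pow_insert
    by (subst sum.union_disjoint[OF _ _ disj]) (simp_all add: sum.reindex[OF inj] o_def)
  also have "(\<Sum>A\<in>Pow (set gs). spectral_proj e (g # gs) A u) =
      (\<Sum>A\<in>Pow (set gs). ?p A - e g (?p A))"
    using g by (intro sum.cong) (auto simp: Let_def)
  also have "(\<Sum>A\<in>Pow (set gs). spectral_proj e (g # gs) (insert g A) u) =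
      (\<Sum>A\<in>Pow (set gs). e g (?p A))"
    using g by (intro sum.cong) (auto simp: Let_def spectral_proj_insert)
  finally show ?case using Cons by (simp add: sum_subtractf)
qed simp

text \<open>On an eigenvector every factor acts as 0 or 1, and as 1 exactly when \<open>A\<close>
  and \<open>B\<close> agree at the element in question.\<close>

lemma spectral_proj_of_eigen:
  "set gs \<subseteq> X \<Longrightarrow> v \<in> eigen B \<Longrightarrow>
    spectral_proj e gs A v = (if A \<inter> set gs = B \<inter> set gs then v else 0)"
proof (induction gs)
  case (Cons g gs)
  then have "g \<in> X" and "e g v = (if g \<in> B then v else 0)" by (auto simp: eigen_def)
  moreover have "A \<inter> set (g # gs) = B \<inter> set (g # gs) \<longleftrightarrow>
      A \<inter> set gs = B \<inter> set gs \<and> (g \<in> A \<longleftrightarrow> g \<in> B)" by auto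
  ultimately show ?case using Cons by (auto simp: Let_def e_zero)
qed simp

text \<open>The enumeration of \<open>X\<close> is arbitrary. Its order never matters, since all
  properties are derived through \<open>component_list\<close>.\<close>

definition component :: "'g set \<Rightarrow> 'u \<Rightarrow> 'u" where
  "component = spectral_proj e (SOME gs. set gs = X \<and> distinct gs)"

lemma component_list:
  obtains gs where "set gs = X" "distinct gs" "component = spectral_proj e gs"
proof -
  show ?thesis
    using someI_ex[OF finite_distinct_list[OF finite_X]] component_def by (intro that) auto
qed

lemma component_in_eigen: "u \<in> U \<Longrightarrow> component A u \<in> eigen A"
  by (rule component_list) (simp add: eigen_def spectral_proj_closed spectral_proj_eigen)

lemma component_closed: "u \<in> U \<Longrightarrow> component A u \<in> U"
  using component_in_eigen by (simp add: eigen_def)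

lemma component_add:
  "u \<in> U \<Longrightarrow> v \<in> U \<Longrightarrow> component A (u + v) = component A u + component A v"
  by (rule component_list) (simp add: spectral_proj_add)

lemma component_scale: "u \<in> U \<Longrightarrow> component A (sU c u) = sU c (component A u)"
  by (rule component_list) (simp add: spectral_proj_scale)

lemma component_zero: "component A 0 = 0"
  by (rule component_list) (simp add: spectral_proj_zero)

lemma component_sum: "(\<Sum>A\<in>Pow X. component A u) = u"
proof (rule component_list)
  fix gs assume "set gs = X" "distinct gs" "component = spectral_proj e gs"
  then show ?thesis using spectral_proj_sum[of gs u] by simp
qed

lemma component_of_eigen:
  assumes "A \<subseteq> X" "B \<subseteq> X" "v \<in> eigen B"
  shows "component A v = (if A = B then v else 0)"
proof (rule component_list)
  fix gs assume "set gs = X" "component = spectral_proj e gs"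
  then show ?thesis
    using spectral_proj_of_eigen[of gs v B A] assms by (simp add: Int_absorb2)
qed

text \<open>Uniqueness of a decomposition into eigenvectors: \<open>component B\<close> kills all
  terms but one. It yields the equivariance of components and the uniqueness of the
  extension.\<close>

lemma component_unique:
  assumes \<A>: "\<A> \<subseteq> Pow X" and v: "\<And>A. A \<in> \<A> \<Longrightarrow> v A \<in> eigen A" and B: "B \<in> \<A>"
  shows "component B (\<Sum>A\<in>\<A>. v A) = v B"
proof -
  have fin: "finite \<A>" using \<A> finite_X by (meson finite_Pow_iff finite_subset)
  \<comment> \<open>Additivity of \<open>component\<close> is available only on \<open>U\<close>, so
    the induction also carries membership of the partial sums.\<close>
  have "(\<Sum>A\<in>\<B>. v A) \<in> U \<and>
      component B (\<Sum>A\<in>\<B>. v A) = (\<Sum>A\<in>\<B>. component B (v A))"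
    if "finite \<B>" "\<B> \<subseteq> \<A>" for \<B>
    using that
  proof (induction \<B> rule: finite_induct)
    case (insert A \<B>)
    moreover have "v A \<in> U" using v insert.prems by (auto simp: eigen_def)
    ultimately show ?case by (simp add: component_add U_closed)
  qed (simp add: U_closed component_zero)
  then have "component B (\<Sum>A\<in>\<A>. v A) = (\<Sum>A\<in>\<A>. component B (v A))" using fin by blast
  also have "\<dots> = (\<Sum>A\<in>\<A>. if A = B then v B else 0)"
  proof (intro sum.cong refl)
    fix A assume "A \<in> \<A>"
    then show "component B (v A) = (if A = B then v B else 0)"
      using component_of_eigen[of B A "v A"] v[of A] \<A> B by (auto simp: subset_iff)
  qed
  also have "\<dots> = v B" using B fin by simp
  finally show ?thesis .
qed

end

section \<open>Unions of left cosets\<close>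

text \<open>A set is a union of left cosets exactly when right multiplication by \<open>H\<close>
  preserves it; such a set contains \<open>H\<close> as soon as it contains
  \<open>\<one>\<close>.\<close>

lemma coset_unions_iff:
  fixes G (structure)
  assumes G: "group G" and H: "subgroup H G"
  shows "A \<in> coset_unions G H \<longleftrightarrow>
    A \<subseteq> carrier G \<and> \<one> \<in> A \<and> (\<forall>a\<in>A. \<forall>h\<in>H. a \<otimes> h \<in> A)"
proof
  interpret group G by fact
  show "A \<subseteq> carrier G \<and> \<one> \<in> A \<and> (\<forall>a\<in>A. \<forall>h\<in>H. a \<otimes> h \<in> A)" if "A \<in> coset_unions G H"
    using that coset_unions_closed[OF G H that] subgroup.one_closed[OF H]
    by (auto simp: coset_unions_def)
  assume A: "A \<subseteq> carrier G \<and> \<one> \<in> A \<and> (\<forall>a\<in>A. \<forall>h\<in>H. a \<otimes> h \<in> A)"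
  have "h \<in> A" if "h \<in> H" for h
  proof -
    have "\<one> \<otimes> h \<in> A" using A that by blast
    then show ?thesis using subgroup.mem_carrier[OF H that] by simp
  qed
  moreover have "A = \<Union>((\<lambda>a. a <# H) ` A)"
  proof
    show "A \<subseteq> \<Union>((\<lambda>a. a <# H) ` A)" using A lcos_self[OF _ H] by blast
  qed (use A in \<open>auto simp: l_coset_def\<close>)
  moreover have "(\<lambda>a. a <# H) ` A \<subseteq> lcosets H" using A by (auto simp: LCOSETS_def)
  ultimately show "A \<in> coset_unions G H" using A unfolding coset_unions_def by (intro CollectI) blast
qed

lemma l_coset_subset_coset_unions_iff:
  fixes G (structure)
  assumes G: "group G" and H: "subgroup H G" and A: "A \<in> coset_unions G H" and g: "g \<in> carrier G"
  shows "g <# H \<subseteq> A \<longleftrightarrow> g \<in> A"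
  using coset_unions_closed[OF G H A _] group.lcos_self[OF G g H] by (force simp: l_coset_def)

lemma (in group) mem_l_coset_iff:
  assumes "A \<subseteq> carrier G" "g \<in> carrier G" "x \<in> carrier G"
  shows "x \<in> g <# A \<longleftrightarrow> inv g \<otimes> x \<in> A"
proof
  assume "x \<in> g <# A"
  then show "inv g \<otimes> x \<in> A" using assms by (auto simp: l_coset_def m_assoc[symmetric])
next
  assume "inv g \<otimes> x \<in> A"
  moreover have "x = g \<otimes> (inv g \<otimes> x)" using assms by (simp add: m_assoc[symmetric])
  ultimately show "x \<in> g <# A" unfolding l_coset_def by blast
qed

section \<open>The idempotents of a partial representation\<close>

locale global_partial_rep_space =
  fixes G (structure) and H :: "'g set" and sU :: "complex \<Rightarrow> 'u::ab_group_add \<Rightarrow> 'u"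
    and U :: "'u set" and \<tau> :: "'g \<Rightarrow> 'u \<Rightarrow> 'u"
  assumes grp: "group G" and finite_G: "finite (carrier G)" and H: "subgroup H G"
    and \<tau>: "global_partial_rep G H sU U \<tau>"
begin

sublocale group G by (rule grp)

lemma H_carrier: "h \<in> H \<Longrightarrow> h \<in> carrier G"
  using subgroup.mem_carrier[OF H] .

lemma U: "fd_space sU U" and \<tau>_lin: "g \<in> carrier G \<Longrightarrow> \<tau> g \<in> lin_maps sU U sU U"
  and \<tau>_one: "\<tau> \<one> = id_map U"
  using \<tau> by (auto simp: global_partial_rep_def partial_rep_def)

lemma \<tau>_closed: "g \<in> carrier G \<Longrightarrow> u \<in> U \<Longrightarrow> \<tau> g u \<in> U"
  and \<tau>_add: "g \<in> carrier G \<Longrightarrow> u \<in> U \<Longrightarrow> v \<in> U \<Longrightarrow> \<tau> g (u + v) = \<tau> g u + \<tau> g v"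
  and \<tau>_scale: "g \<in> carrier G \<Longrightarrow> u \<in> U \<Longrightarrow> \<tau> g (sU c u) = sU c (\<tau> g u)"
  and \<tau>_outside: "g \<in> carrier G \<Longrightarrow> u \<notin> U \<Longrightarrow> \<tau> g u = 0"
  using \<tau>_lin unfolding lin_maps_def by blast+

lemma \<tau>_zero: "g \<in> carrier G \<Longrightarrow> \<tau> g 0 = 0"
  using zero_lin_map(2)[OF U U \<tau>_lin] .

text \<open>Since \<open>\<tau> \<one>\<close> is \<open>id_map U\<close>, which differs from the
  identity function outside \<open>U\<close>, this absorption rule lets operator identities be
  stated for all \<open>u\<close>.\<close>

lemma \<tau>_id: "g \<in> carrier G \<Longrightarrow> \<tau> g (id_map U u) = \<tau> g u"
  by (simp add: id_map_def \<tau>_outside \<tau>_zero)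

lemma \<tau>_left:
  assumes "g \<in> carrier G" "h \<in> carrier G"
  shows "\<tau> (inv g) (\<tau> g (\<tau> h u)) = \<tau> (inv g) (\<tau> (g \<otimes> h) u)"
proof -
  have "\<tau> (inv g) \<circ> \<tau> (g \<otimes> h) = \<tau> (inv g) \<circ> \<tau> g \<circ> \<tau> h"
    using \<tau> assms unfolding global_partial_rep_def partial_rep_def by blast
  from fun_cong[OF this, of u] show ?thesis by simp
qed

lemma \<tau>_right:
  assumes "g \<in> carrier G" "h \<in> carrier G"
  shows "\<tau> g (\<tau> h (\<tau> (inv h) u)) = \<tau> (g \<otimes> h) (\<tau> (inv h) u)"
proof -
  have "\<tau> (g \<otimes> h) \<circ> \<tau> (inv h) = \<tau> g \<circ> \<tau> h \<circ> \<tau> (inv h)"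
    using \<tau> assms unfolding global_partial_rep_def partial_rep_def by blast
  from fun_cong[OF this, of u] show ?thesis by simp
qed

text \<open>The left axiom for the pair \<open>inv g\<close>, \<open>g\<close>, whose product is
  \<open>\<one>\<close>. Thus \<open>\<tau> (inv g)\<close> is a generalised inverse of
  \<open>\<tau> g\<close>, which makes \<open>\<epsilon> g\<close> idempotent.\<close>

lemma \<tau>_inv_cancel: "g \<in> carrier G \<Longrightarrow> \<tau> g (\<tau> (inv g) (\<tau> g u)) = \<tau> g u"
  using \<tau>_left[of "inv g" g u] by (simp add: \<tau>_one \<tau>_id)

lemma \<tau>_H_mult: "h \<in> H \<Longrightarrow> k \<in> H \<Longrightarrow> \<tau> (h \<otimes> k) u = \<tau> h (\<tau> k u)"
  using \<tau> unfolding global_partial_rep_def representation_def by simp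

lemma \<tau>_H_inv:
  "h \<in> H \<Longrightarrow> \<tau> (inv h) (\<tau> h u) = id_map U u"
  "h \<in> H \<Longrightarrow> \<tau> h (\<tau> (inv h) u) = id_map U u"
  using \<tau>_H_mult[of "inv h" h u] \<tau>_H_mult[of h "inv h" u] subgroup.m_inv_closed[OF H] H_carrier[of h]
  by (simp_all add: \<tau>_one)

text \<open>On \<open>H\<close> the operators are invertible, so
  \<open>\<tau> (inv h) (\<tau> h u)\<close> can be inserted to bring the right axiom into
  play.\<close>

lemma \<tau>_mult_H:
  assumes "g \<in> carrier G" "h \<in> H"
  shows "\<tau> (g \<otimes> h) u = \<tau> g (\<tau> h u)"
proof -
  have h: "h \<in> carrier G" using assms H_carrier by blast
  have "\<tau> (g \<otimes> h) u = \<tau> (g \<otimes> h) (\<tau> (inv h) (\<tau> h u))"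
    using assms h by (simp add: \<tau>_H_inv \<tau>_id)
  also have "\<dots> = \<tau> g (\<tau> h (\<tau> (inv h) (\<tau> h u)))" using \<tau>_right[OF assms(1) h] by simp
  finally show ?thesis using h by (simp add: \<tau>_inv_cancel)
qed

text \<open>The mirror image by the left axiom. The inserted product acts as the identity on
  \<open>U\<close> only, hence \<open>in_U\<close>.\<close>

lemma \<tau>_H_mult_left:
  assumes "g \<in> carrier G" "h \<in> H"
  shows "\<tau> (h \<otimes> g) u = \<tau> h (\<tau> g u)"
proof -
  have h: "h \<in> carrier G" using assms H_carrier by blast
  have in_U: "\<tau> x u \<in> U" if "x \<in> carrier G" for x
    using that \<tau>_closed[of x] \<tau>_outside[of x u] zero_lin_map(1)[OF U U \<tau>_lin[of x]]
    by (cases "u \<in> U") auto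
  have "\<tau> (h \<otimes> g) u = \<tau> h (\<tau> (inv h) (\<tau> (h \<otimes> g) u))"
    using assms h in_U by (simp add: \<tau>_H_inv id_map_def)
  also have "\<dots> = \<tau> h (\<tau> (inv h) (\<tau> h (\<tau> g u)))" using \<tau>_left[OF h assms(1)] by simp
  finally show ?thesis using h by (simp add: \<tau>_inv_cancel)
qed

definition \<epsilon> :: "'g \<Rightarrow> 'u \<Rightarrow> 'u" where
  "\<epsilon> g u = \<tau> g (\<tau> (inv g) u)"

text \<open>Both sides equal \<open>\<tau> (g \<otimes> h) (\<tau> (inv h) u)\<close>: the left one
  by the right axiom, the right one by the left axiom for \<open>inv (g \<otimes> h)\<close> and
  \<open>g\<close>.\<close>

lemma \<tau>_\<epsilon>:
  assumes "g \<in> carrier G" "h \<in> carrier G"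
  shows "\<tau> g (\<epsilon> h u) = \<epsilon> (g \<otimes> h) (\<tau> g u)"
proof -
  have "inv (g \<otimes> h) \<otimes> g = inv h" using assms by (simp add: inv_mult_group m_assoc)
  then have "\<tau> (g \<otimes> h) (\<tau> (inv (g \<otimes> h)) (\<tau> g u)) = \<tau> (g \<otimes> h) (\<tau> (inv h) u)"
    using \<tau>_left[of "inv (g \<otimes> h)" g u] assms by simp
  then show ?thesis using \<tau>_right[OF assms] by (simp add: \<epsilon>_def)
qed

text \<open>Splitting off \<open>h\<close> and \<open>inv h\<close> from the two factors of
  \<open>\<epsilon> (g \<otimes> h)\<close> leaves \<open>\<tau> h\<close> next to its inverse in
  the middle.\<close>

lemma \<epsilon>_mult_H:
  assumes "g \<in> carrier G" "h \<in> H"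
  shows "\<epsilon> (g \<otimes> h) u = \<epsilon> g u"
  using assms H_carrier[of h] subgroup.m_inv_closed[OF H assms(2)]
  by (simp add: \<epsilon>_def inv_mult_group \<tau>_H_mult_left \<tau>_mult_H \<tau>_H_inv \<tau>_id)

sublocale commuting_idempotents "carrier G" sU U \<epsilon>
proof
  show "finite (carrier G)" by (rule finite_G)
  show "fd_space sU U" by (rule U)
  fix g u assume g: "g \<in> carrier G"
  show "\<epsilon> g \<in> lin_maps sU U sU U"
    using g by (auto simp: lin_maps_def \<epsilon>_def \<tau>_closed \<tau>_add \<tau>_scale \<tau>_outside \<tau>_zero)
  show "\<epsilon> g (\<epsilon> g u) = \<epsilon> g u" using g by (simp add: \<epsilon>_def \<tau>_inv_cancel)
  fix h assume h: "h \<in> carrier G"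
  \<comment> \<open>Moving \<open>\<epsilon> h\<close> past the two factors of
    \<open>\<epsilon> g\<close> changes its index to \<open>inv g \<otimes> h\<close> and then back
    to \<open>h\<close>.\<close>
  have "\<epsilon> g (\<epsilon> h u) = \<tau> g (\<epsilon> (inv g \<otimes> h) (\<tau> (inv g) u))"
    using g h by (simp add: \<epsilon>_def[of g] \<tau>_\<epsilon>)
  also have "\<dots> = \<epsilon> h (\<epsilon> g u)"
    using g h by (simp add: \<tau>_\<epsilon> \<epsilon>_def[of g] m_assoc[symmetric])
  finally show "\<epsilon> g (\<epsilon> h u) = \<epsilon> h (\<epsilon> g u)" .
qed

text \<open>If \<open>\<one>\<close> is missing, \<open>\<epsilon> \<one>\<close> acts on
  \<open>v\<close> both as 1 and as 0. Otherwise some \<open>a\<close> in \<open>A\<close> has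
  \<open>a \<otimes> h\<close> outside \<open>A\<close>, and the equal operators
  \<open>\<epsilon> a\<close> and \<open>\<epsilon> (a \<otimes> h)\<close> act on \<open>v\<close>
  as 1 and as 0.\<close>

lemma eigen_not_coset_union:
  assumes v: "v \<in> eigen A" and A: "A \<subseteq> carrier G" "A \<notin> coset_unions G H"
  shows "v = 0"
proof (cases "\<one> \<in> A")
  case True
  then obtain a h where ah: "a \<in> A" "h \<in> H" "a \<otimes> h \<notin> A"
    using A coset_unions_iff[OF grp H] by blast
  then have "a \<in> carrier G" "a \<otimes> h \<in> carrier G" using A H_carrier[OF ah(2)] by auto
  then show ?thesis using \<epsilon>_mult_H[of a h v] v ah by (auto simp: eigen_def)
next
  case False
  have "\<epsilon> \<one> v = v" using v by (simp add: \<epsilon>_def \<tau>_one id_map_def eigen_def)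
  then show ?thesis using v False by (simp add: eigen_def)
qed

lemma component_sum_coset_unions:
  assumes "u \<in> U"
  shows "(\<Sum>A\<in>coset_unions G H. component A u) = u"
proof -
  have "(\<Sum>A\<in>coset_unions G H. component A u) = (\<Sum>A\<in>Pow (carrier G). component A u)"
    using finite_G eigen_not_coset_union[OF component_in_eigen[OF assms]]
    by (intro sum.mono_neutral_left) (auto simp: coset_unions_def)
  then show ?thesis by (simp add: component_sum)
qed

lemma \<tau>_eigen:
  assumes v: "v \<in> eigen A" and A: "A \<subseteq> carrier G" and g: "g \<in> carrier G"
  shows "\<tau> g v \<in> eigen (g <# A)"
  unfolding eigen_def
proof (intro CollectI conjI ballI)
  show "\<tau> g v \<in> U" using v g by (simp add: eigen_def \<tau>_closed)
  fix x assume x: "x \<in> carrier G"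
  have "\<epsilon> x (\<tau> g v) = \<tau> g (\<epsilon> (inv g \<otimes> x) v)"
    using g x by (simp add: \<tau>_\<epsilon> m_assoc[symmetric])
  then show "\<epsilon> x (\<tau> g v) = (if x \<in> g <# A then \<tau> g v else 0)"
    using v g x by (simp add: eigen_def mem_l_coset_iff[OF A g x] \<tau>_zero)
qed

text \<open>Here \<open>v = \<tau> (inv x) (\<tau> x v)\<close>, which supplies the factor
  \<open>\<tau> (inv x)\<close> that the right axiom requires.\<close>

lemma \<tau>_mult_eigen:
  assumes v: "v \<in> eigen A" and x: "x \<in> carrier G" "inv x \<in> A" and g: "g \<in> carrier G"
  shows "\<tau> g (\<tau> x v) = \<tau> (g \<otimes> x) v"
proof -
  have "\<epsilon> (inv x) v = v" using v x by (simp add: eigen_def)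
  then show ?thesis using \<tau>_right[OF g x(1), of "\<tau> x v"] x \<tau>_inv_cancel[OF x(1)]
    by (simp add: \<epsilon>_def)
qed

text \<open>By cancellation \<open>\<tau> x v = \<tau> x (\<epsilon> (inv x) v)\<close>, and the
  inner vector is 0.\<close>

lemma \<tau>_eigen_eq_0:
  assumes v: "v \<in> eigen A" and x: "x \<in> carrier G" "inv x \<notin> A"
  shows "\<tau> x v = 0"
proof -
  have "\<epsilon> (inv x) v = 0" using v x by (simp add: eigen_def)
  then show ?thesis using \<tau>_inv_cancel[OF x(1), of v] x by (simp add: \<epsilon>_def \<tau>_zero)
qed

lemma \<tau>_sum:
  assumes g: "g \<in> carrier G" and v: "\<And>i. i \<in> I \<Longrightarrow> v i \<in> U"
  shows "\<tau> g (\<Sum>i\<in>I. v i) = (\<Sum>i\<in>I. \<tau> g (v i))"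
proof -
  have "(\<Sum>i\<in>I. v i) \<in> U \<and> \<tau> g (\<Sum>i\<in>I. v i) = (\<Sum>i\<in>I. \<tau> g (v i))"
    using v by (induction I rule: infinite_finite_induct) (auto simp: U_closed \<tau>_zero \<tau>_add g)
  then show ?thesis ..
qed

text \<open>Applying \<open>\<tau> h\<close> to the decomposition of \<open>u\<close> gives a sum of
  eigenvectors equal to \<open>\<tau> h u\<close>; uniqueness identifies the terms.\<close>

lemma \<tau>_component:
  assumes u: "u \<in> U" and h: "h \<in> H" and B: "B \<subseteq> carrier G"
  shows "component (h <# B) (\<tau> h u) = \<tau> h (component B u)"
proof -
  have hG: "h \<in> carrier G" using h H_carrier by blast
  have inv_h: "inv h <# (h <# A) = A" "h <# (inv h <# A) = A" if "A \<subseteq> carrier G" for A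
    using that hG by (simp_all add: lcos_m_assoc lcos_mult_one)
  have bij: "bij_betw (\<lambda>A. inv h <# A) (Pow (carrier G)) (Pow (carrier G))"
    using hG inv_h
    by (intro bij_betw_byWitness[where f' = "\<lambda>A. h <# A"] image_subsetI PowI l_coset_subset_G) auto
  \<comment> \<open>Indexed by the target set, so that \<open>v A\<close> lies in
    \<open>eigen A\<close>; the bijection \<open>bij\<close> restores the original sum.\<close>
  define v where "v A = \<tau> h (component (inv h <# A) u)" for A
  have v: "v A \<in> eigen A" if "A \<in> Pow (carrier G)" for A
    using \<tau>_eigen[OF component_in_eigen[OF u] _ hG, of "inv h <# A"] that hG
    by (auto simp: v_def inv_h l_coset_subset_G)
  have "(\<Sum>A\<in>Pow (carrier G). v A) = \<tau> h (\<Sum>A\<in>Pow (carrier G). component (inv h <# A) u)"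
    unfolding v_def by (rule \<tau>_sum[OF hG component_closed[OF u], symmetric])
  also have "(\<Sum>A\<in>Pow (carrier G). component (inv h <# A) u) = u"
    using sum.reindex_bij_betw[OF bij, of "\<lambda>A. component A u"] by (simp add: component_sum)
  finally have "component (h <# B) (\<tau> h u) = v (h <# B)"
    using component_unique[OF order_refl v, of "h <# B"] l_coset_subset_G[OF B hG] by simp
  then show ?thesis using B by (simp add: v_def inv_h)
qed

end

section \<open>Linear maps on the induced space\<close>

lemma lin_mapsD:
  assumes "f \<in> lin_maps sV V sU U"
  shows "v \<in> V \<Longrightarrow> f v \<in> U"
    and "v \<in> V \<Longrightarrow> v' \<in> V \<Longrightarrow> f (v + v') = f v + f v'"
    and "v \<in> V \<Longrightarrow> f (sV c v) = sU c (f v)"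
    and "v \<notin> V \<Longrightarrow> f v = 0"
  using assms unfolding lin_maps_def by blast+

lemma lin_maps_comp:
  assumes "f \<in> lin_maps sV V sU U" "g \<in> lin_maps sU U sT T" "fd_space sU U" "fd_space sT T"
  shows "g \<circ> f \<in> lin_maps sV V sT T"
  using lin_mapsD[OF assms(1)] lin_mapsD[OF assms(2)] zero_lin_map(2)[OF assms(3,4,2)]
  by (simp add: lin_maps_def)

lemma lin_map_sum:
  assumes "fd_space sV V" "fd_space sU U" "f \<in> lin_maps sV V sU U" and v: "\<And>i. i \<in> I \<Longrightarrow> v i \<in> V"
  shows "f (\<Sum>i\<in>I. v i) = (\<Sum>i\<in>I. f (v i))"
proof -
  interpret V: vector_space sV using assms(1) by (simp add: fd_space_def)
  have V: "V.subspace V" using assms(1) by (simp add: fd_space_def)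
  show ?thesis
    using v
    by (induction I rule: infinite_finite_induct)
      (simp_all add: zero_lin_map[OF assms(1-3)] lin_mapsD(2)[OF assms(3)] V.subspace_sum[OF V])
qed

lemma vector_space_fun_scale:
  assumes "vector_space s"
  shows "vector_space (fun_scale s)"
proof -
  interpret vector_space s by fact
  show ?thesis
    by standard (auto simp: fun_scale_def fun_eq_iff scale_right_distrib scale_left_distrib)
qed

section \<open>The setting of the theorem: coset unions, indices and the direct sum\<close>

locale partial_induction =
  fixes G (structure) and H :: "'g set" and r :: nat and \<gamma> :: "nat \<Rightarrow> 'g"
    and sW :: "complex \<Rightarrow> 'w::ab_group_add \<Rightarrow> 'w" and W :: "'w set" and \<rho> :: "'g \<Rightarrow> 'w \<Rightarrow> 'w"
    and sX :: "complex \<Rightarrow> 'x::ab_group_add \<Rightarrow> 'x" and S :: "'g set \<Rightarrow> nat \<Rightarrow> 'x set"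
    and \<phi> :: "'g set \<Rightarrow> nat \<Rightarrow> 'w \<Rightarrow> 'x"
  assumes grp: "group G" and finite_G: "finite (carrier G)" and H: "subgroup H G"
    and \<gamma>: "coset_reps G H r \<gamma>"
    and \<rho>: "representation (G\<lparr>carrier := H\<rparr>) sW W \<rho>"
    and S: "(A, i) \<in> pind_index G H r \<gamma> \<Longrightarrow> fd_space sX (S A i)"
    and \<phi>: "(A, i) \<in> pind_index G H r \<gamma> \<Longrightarrow> \<phi> A i \<in> lin_isos sW W sX (S A i)"
begin

sublocale group G by (rule grp)

abbreviation "CU \<equiv> coset_unions G H"
abbreviation "I \<equiv> pind_index G H r \<gamma>"
abbreviation "P \<equiv> pind_space G H r \<gamma> S"
abbreviation "sP \<equiv> fun_scale sX"
abbreviation "\<rho>' \<equiv> pind_rep G H r \<gamma> W \<rho> S \<phi>"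
abbreviation "\<eta> \<equiv> pind_unit G H \<phi>"

lemma H_carrier: "h \<in> H \<Longrightarrow> h \<in> carrier G"
  using subgroup.mem_carrier[OF H] .

lemma W: "fd_space sW W"
  and \<rho>_lin: "h \<in> H \<Longrightarrow> \<rho> h \<in> lin_maps sW W sW W"
  and \<rho>_one: "\<rho> \<one> = id_map W"
  and \<rho>_mult: "h \<in> H \<Longrightarrow> k \<in> H \<Longrightarrow> \<rho> (h \<otimes> k) = \<rho> h \<circ> \<rho> k"
  using \<rho> by (simp_all add: representation_def)

lemmas \<rho>_closed = lin_mapsD(1)[OF \<rho>_lin]

lemma W_zero: "0 \<in> W"
  using zero_lin_map(1)[OF W W \<rho>_lin[OF subgroup.one_closed[OF H]]] .

lemma \<gamma>_carrier: "i \<in> {1..r} \<Longrightarrow> \<gamma> i \<in> carrier G" and \<gamma>_one: "\<gamma> 1 = \<one>"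
  using \<gamma> unfolding coset_reps_def by blast+

text \<open>That \<open>r\<close> is positive is not part of \<open>coset_reps\<close>; it follows
  because some coset must cover \<open>\<one>\<close>.\<close>

lemma one_index: "1 \<in> {1..r}"
proof -
  obtain j where "j \<in> {1..r}" using coset_index_decomp[OF grp H \<gamma> one_closed] .
  then show ?thesis by simp
qed

lemma finite_I: "finite I"
  by (rule finite_pind_index[OF finite_G])

lemma CU_subset: "A \<in> CU \<Longrightarrow> A \<subseteq> carrier G"
  and CU_one: "A \<in> CU \<Longrightarrow> \<one> \<in> A"
  and CU_closed: "A \<in> CU \<Longrightarrow> a \<in> A \<Longrightarrow> h \<in> H \<Longrightarrow> a \<otimes> h \<in> A"
  by (simp_all add: coset_unions_iff[OF grp H])

lemma CU_carrier: "A \<in> CU \<Longrightarrow> a \<in> A \<Longrightarrow> a \<in> carrier G"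
  using CU_subset by blast

lemma CU_H: "A \<in> CU \<Longrightarrow> h \<in> H \<Longrightarrow> h \<in> A"
  using CU_closed[OF _ CU_one, of A h] H_carrier by simp

lemma CU_l_coset: "A \<in> CU \<Longrightarrow> g \<in> carrier G \<Longrightarrow> inv g \<in> A \<Longrightarrow> g <# A \<in> CU"
  by (rule coset_unions_l_coset[OF grp H]) (simp_all add: l_coset_subset_coset_unions_iff[OF grp H])

lemma I_iff: "(A, i) \<in> I \<longleftrightarrow> A \<in> CU \<and> i \<in> {1..r} \<and> \<gamma> i \<in> A"
  using l_coset_subset_coset_unions_iff[OF grp H _ \<gamma>_carrier] by (auto simp: pind_index_def)

text \<open>The laws of \<open>sX\<close> are given only through the summands, so an index has to be
  exhibited: the whole group with the trivial coset.\<close>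

lemma vs_X: "vector_space sX"
proof -
  have "carrier G \<in> CU" using H_carrier by (simp add: coset_unions_iff[OF grp H])
  then have "(carrier G, 1) \<in> I" unfolding I_iff using one_index \<gamma>_carrier by blast
  from S[OF this] show ?thesis by (simp add: fd_space_def)
qed

sublocale X: vector_space sX by (rule vs_X)
sublocale P: vector_space sP by (rule vector_space_fun_scale[OF vs_X])
sublocale W: vector_space sW using W by (simp add: fd_space_def)

lemma \<phi>_lin: "(A, i) \<in> I \<Longrightarrow> \<phi> A i \<in> lin_maps sW W sX (S A i)"
  and \<phi>_bij: "(A, i) \<in> I \<Longrightarrow> bij_betw (\<phi> A i) W (S A i)"
  using \<phi> by (simp_all add: lin_isos_def)

lemma subspace_S: "(A, i) \<in> I \<Longrightarrow> X.subspace (S A i)"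
  using S by (simp add: fd_space_def)

lemma subspace_W: "W.subspace W"
  using W by (simp add: fd_space_def)

lemma P_I: "(\<And>A i. (A, i) \<in> I \<Longrightarrow> x (A, i) \<in> S A i) \<Longrightarrow> (\<And>k. k \<notin> I \<Longrightarrow> x k = 0) \<Longrightarrow> x \<in> P"
  and P_mem: "x \<in> P \<Longrightarrow> (A, i) \<in> I \<Longrightarrow> x (A, i) \<in> S A i"
  and P_outside: "x \<in> P \<Longrightarrow> k \<notin> I \<Longrightarrow> x k = 0"
  unfolding pind_space_def by blast+

lemma subspace_P: "P.subspace P"
  unfolding P.subspace_def
  by (intro conjI ballI allI P_I)
    (simp_all add: fun_scale_def P_mem P_outside X.subspace_0[OF subspace_S]
      X.subspace_add[OF subspace_S] X.subspace_scale[OF subspace_S])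

lemma incl_in_P: "(A, i) \<in> I \<Longrightarrow> w \<in> W \<Longrightarrow> pind_incl \<phi> A i w \<in> P"
  using X.subspace_0[OF subspace_S] lin_mapsD(1)[OF \<phi>_lin]
  by (auto simp: pind_space_def pind_incl_def)

lemma incl_lin:
  assumes k: "(A, i) \<in> I"
  shows "pind_incl \<phi> A i \<in> lin_maps sW W sP P"
  using lin_mapsD[OF \<phi>_lin[OF k]] incl_in_P[OF k]
  by (auto simp: lin_maps_def pind_incl_def fun_scale_def fun_eq_iff)

section \<open>Coordinates, decomposition and finite dimension of the direct sum\<close>

definition coord :: "'g set \<Rightarrow> nat \<Rightarrow> ('g set \<times> nat \<Rightarrow> 'x) \<Rightarrow> 'w" where
  "coord A i x = inv_into W (\<phi> A i) (x (A, i))"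

lemma coord_closed: "x \<in> P \<Longrightarrow> (A, i) \<in> I \<Longrightarrow> coord A i x \<in> W"
  unfolding coord_def using \<phi>_bij[of A i] P_mem[of x A i]
  by (metis bij_betw_imp_surj_on inv_into_into)

lemma \<phi>_coord: "x \<in> P \<Longrightarrow> (A, i) \<in> I \<Longrightarrow> \<phi> A i (coord A i x) = x (A, i)"
  unfolding coord_def using \<phi>_bij[of A i] P_mem[of x A i]
  by (metis bij_betw_imp_surj_on f_inv_into_f)

lemma coord_eqI: "(A, i) \<in> I \<Longrightarrow> w \<in> W \<Longrightarrow> \<phi> A i w = x (A, i) \<Longrightarrow> coord A i x = w"
  unfolding coord_def using \<phi>_bij[of A i] by (auto simp: bij_betw_def intro: inv_into_f_eq)

lemma coord_add:
  "x \<in> P \<Longrightarrow> y \<in> P \<Longrightarrow> (A, i) \<in> I \<Longrightarrow> coord A i (x + y) = coord A i x + coord A i y"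
  by (rule coord_eqI)
    (simp_all add: W.subspace_add[OF subspace_W] coord_closed lin_mapsD(2)[OF \<phi>_lin] \<phi>_coord)

lemma coord_scale: "x \<in> P \<Longrightarrow> (A, i) \<in> I \<Longrightarrow> coord A i (sP c x) = sW c (coord A i x)"
  by (rule coord_eqI)
    (simp_all add: W.subspace_scale[OF subspace_W] coord_closed lin_mapsD(3)[OF \<phi>_lin] \<phi>_coord
      fun_scale_def)

lemma coord_incl:
  assumes "(A, i) \<in> I" "(B, j) \<in> I" "w \<in> W"
  shows "coord B j (pind_incl \<phi> A i w) = (if (B, j) = (A, i) then w else 0)"
  using assms zero_lin_map(2)[OF W S \<phi>_lin] W_zero
  by (intro coord_eqI) (auto simp: pind_incl_def)

lemma P_decomp:
  assumes x: "x \<in> P"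
  shows "x = (\<Sum>(A, i)\<in>I. pind_incl \<phi> A i (coord A i x))"
proof
  fix k :: "'g set \<times> nat"
  have eval: "(\<Sum>(A, i)\<in>J. pind_incl \<phi> A i (coord A i x)) k = (if k \<in> J then x k else 0)"
    if "finite J" "J \<subseteq> I" for J
    using that
    by (induction J rule: finite_induct) (auto simp: pind_incl_def \<phi>_coord[OF x] split_def)
  show "x k = (\<Sum>(A, i)\<in>I. pind_incl \<phi> A i (coord A i x)) k"
    unfolding eval[OF finite_I order_refl] using P_outside[OF x, of k] by presburger
qed

text \<open>The images of a finite spanning set of \<open>W\<close> in the finitely many summands
  span the direct sum.\<close>

lemma fd_P: "fd_space sP P"
proof -
  obtain BW where BW: "finite BW" "BW \<subseteq> W" "W.span BW = W"
    using W by (auto simp: fd_space_def)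
  define B where "B = (\<Union>(A, i)\<in>I. pind_incl \<phi> A i ` BW)"
  have B: "B \<subseteq> P" using BW incl_in_P by (auto simp: B_def)
  have incl: "pind_incl \<phi> A i w \<in> P.span B" if k: "(A, i) \<in> I" and w: "w \<in> W" for A i w
  proof -
    have "w \<in> W \<and> pind_incl \<phi> A i w \<in> P.span B"
      if "w \<in> W.span BW" for w
      using that
    proof (induction rule: W.span_induct_alt)
      case base
      have "pind_incl \<phi> A i 0 = 0"
        using zero_lin_map(2)[OF W S[OF k] \<phi>_lin[OF k]] by (simp add: fun_eq_iff pind_incl_def)
      show ?case unfolding \<open>pind_incl \<phi> A i 0 = 0\<close> using W_zero P.span_zero by blast
    next
      case (step c v w)
      then have v: "v \<in> W" "pind_incl \<phi> A i v \<in> B" using BW k by (auto simp: B_def)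
      have w: "w \<in> W" and cv: "sW c v \<in> W"
        using step v W.subspace_scale[OF subspace_W] by blast+
      have eq: "pind_incl \<phi> A i (sW c v + w) = sP c (pind_incl \<phi> A i v) + pind_incl \<phi> A i w"
        by (simp only: lin_mapsD(2)[OF incl_lin[OF k] cv w] lin_mapsD(3)[OF incl_lin[OF k] v(1)])
      have "sP c (pind_incl \<phi> A i v) + pind_incl \<phi> A i w \<in> P.span B"
        using step v by (blast intro: P.span_add P.span_scale P.span_base)
      then show ?case unfolding eq using W.subspace_add[OF subspace_W cv w] by blast
    qed
    then show ?thesis using w BW by blast
  qed
  have "x \<in> P.span B" if "x \<in> P" for x
    by (subst P_decomp[OF that], rule P.span_sum) (use incl coord_closed[OF that] in auto)
  moreover have "P.span B \<subseteq> P" using P.span_minimal[OF B subspace_P] .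
  moreover have "finite B" using BW finite_I by (auto simp: B_def)
  ultimately show ?thesis
    using B subspace_P P.vector_space_axioms unfolding fd_space_def by blast
qed

text \<open>The map out of the direct sum with prescribed restrictions \<open>t A i\<close> to the
  summands. Both \<open>\<rho>'\<close> and \<open>extension\<close> are of this form, so linearity
  and values on summands are settled once.\<close>

definition lift :: "('g set \<Rightarrow> nat \<Rightarrow> 'w \<Rightarrow> 't::ab_group_add) \<Rightarrow> ('g set \<times> nat \<Rightarrow> 'x) \<Rightarrow> 't" where
  "lift t x = (if x \<in> P then \<Sum>(A, i)\<in>I. t A i (coord A i x) else 0)"

lemma \<rho>'_eq_lift: "\<rho>' g = lift (pind_rep_gen G H r \<gamma> \<rho> \<phi> g)"
  by (simp add: fun_eq_iff pind_rep_def lift_def coord_def)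

lemma lift_lin:
  assumes T: "fd_space sT T" and t: "\<And>A i. (A, i) \<in> I \<Longrightarrow> t A i \<in> lin_maps sW W sT T"
  shows "lift t \<in> lin_maps sP P sT T"
proof -
  interpret T: vector_space sT using T by (simp add: fd_space_def)
  have sub: "T.subspace T" using T by (simp add: fd_space_def)
  have "lift t x \<in> T" if "x \<in> P" for x
    using that lin_mapsD(1)[OF t] coord_closed
    by (auto simp: lift_def intro!: T.subspace_sum[OF sub])
  moreover have "lift t (x + y) = lift t x + lift t y" if "x \<in> P" "y \<in> P" for x y
    using that P.subspace_add[OF subspace_P that]
    by (auto simp: lift_def coord_add coord_closed lin_mapsD(2)[OF t] split_def
        sum.distrib[symmetric] intro!: sum.cong)
  moreover have "lift t (sP c x) = sT c (lift t x)" if "x \<in> P" for c x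
    using that P.subspace_scale[OF subspace_P that]
    by (auto simp: lift_def coord_scale coord_closed lin_mapsD(3)[OF t] split_def
        T.scale_sum_right intro!: sum.cong)
  ultimately show ?thesis by (auto simp: lin_maps_def lift_def)
qed

lemma lift_incl:
  assumes T: "fd_space sT T" and t: "\<And>A i. (A, i) \<in> I \<Longrightarrow> t A i \<in> lin_maps sW W sT T"
    and k: "(A, i) \<in> I" and w: "w \<in> W"
  shows "lift t (pind_incl \<phi> A i w) = t A i w"
proof -
  have "lift t (pind_incl \<phi> A i w) = (\<Sum>k\<in>I. if k = (A, i) then t A i w else 0)"
    unfolding lift_def using incl_in_P[OF k w]
    by (auto simp: coord_incl[OF k _ w] zero_lin_map(2)[OF W T t] intro!: sum.cong)
  then show ?thesis using k finite_I by simp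
qed

lemma lin_maps_P_eqI:
  assumes T: "fd_space sT T" and f: "f \<in> lin_maps sP P sT T" "f' \<in> lin_maps sP P sT T"
    and eq: "\<And>A i w. (A, i) \<in> I \<Longrightarrow> w \<in> W \<Longrightarrow> f (pind_incl \<phi> A i w) = f' (pind_incl \<phi> A i w)"
  shows "f = f'"
proof
  fix x
  show "f x = f' x"
  proof (cases "x \<in> P")
    case True
    have *: "h x = (\<Sum>(A, i)\<in>I. h (pind_incl \<phi> A i (coord A i x)))"
      if h: "h \<in> lin_maps sP P sT T" for h
    proof -
      have "h (\<Sum>(A, i)\<in>I. pind_incl \<phi> A i (coord A i x)) =
          (\<Sum>(A, i)\<in>I. h (pind_incl \<phi> A i (coord A i x)))"
        unfolding split_def
        by (rule lin_map_sum[OF fd_P T h]) (use incl_in_P coord_closed True in auto)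
      then show ?thesis using P_decomp[OF True] by simp
    qed
    show ?thesis
      unfolding *[OF f(1)] *[OF f(2)] using eq coord_closed True by (auto intro!: sum.cong)
  qed (simp add: lin_mapsD(4)[OF f(1)] lin_mapsD(4)[OF f(2)])
qed

text \<open>
  In the summand of index \<open>(A, j)\<close> with \<open>x \<in> \<gamma> j H \<subseteq> A\<close>, the element \<open>vec A x w\<close> plays the role of
  \<open>x \<otimes> w\<close> in the usual induced module, so that \<open>vec A (x h) w = vec A x (\<rho> h w)\<close> for \<open>h \<in> H\<close>.
\<close>

definition vec :: "'g set \<Rightarrow> 'g \<Rightarrow> 'w \<Rightarrow> 'g set \<times> nat \<Rightarrow> 'x" where
  "vec A x w = (let j = coset_index G H r \<gamma> x in pind_incl \<phi> A j (\<rho> (inv (\<gamma> j) \<otimes> x) w))"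

lemma vec_rep_mult: "j \<in> {1..r} \<Longrightarrow> h \<in> H \<Longrightarrow> vec A (\<gamma> j \<otimes> h) w = pind_incl \<phi> A j (\<rho> h w)"
  by (simp add: vec_def coset_index_mult[OF grp H \<gamma>])

lemma vec_rep: "j \<in> {1..r} \<Longrightarrow> w \<in> W \<Longrightarrow> vec A (\<gamma> j) w = pind_incl \<phi> A j w"
  using vec_rep_mult[of j \<one> A w] subgroup.one_closed[OF H] \<gamma>_carrier
  by (simp add: \<rho>_one id_map_def)

lemma CU_decomp:
  assumes A: "A \<in> CU" and x: "x \<in> A"
  obtains j h where "(A, j) \<in> I" "j \<in> {1..r}" "h \<in> H" "x = \<gamma> j \<otimes> h"
proof -
  obtain j h where jh: "j \<in> {1..r}" "h \<in> H" "x = \<gamma> j \<otimes> h"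
    using coset_index_decomp[OF grp H \<gamma> CU_carrier[OF A x]] .
  have "\<gamma> j = x \<otimes> inv h" using jh \<gamma>_carrier H_carrier by (simp add: m_assoc)
  then have "(A, j) \<in> I"
    using jh(1) A CU_closed[OF A x subgroup.m_inv_closed[OF H jh(2)]] by (simp add: I_iff)
  then show ?thesis using jh that by blast
qed

lemma vec_mult_H:
  assumes "x \<in> carrier G" "h \<in> H"
  shows "vec A (x \<otimes> h) w = vec A x (\<rho> h w)"
proof -
  obtain j k where jk: "j \<in> {1..r}" "k \<in> H" "x = \<gamma> j \<otimes> k"
    using coset_index_decomp[OF grp H \<gamma> assms(1)] .
  have "x \<otimes> h = \<gamma> j \<otimes> (k \<otimes> h)"
    using jk assms \<gamma>_carrier H_carrier by (simp add: m_assoc)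
  then show ?thesis
    using jk assms subgroup.m_closed[OF H] by (simp add: vec_rep_mult \<rho>_mult)
qed

lemma vec_lin:
  assumes "A \<in> CU" "x \<in> A"
  shows "vec A x \<in> lin_maps sW W sP P"
proof (rule CU_decomp[OF assms])
  fix j h assume jh: "(A, j) \<in> I" "j \<in> {1..r}" "h \<in> H" "x = \<gamma> j \<otimes> h"
  have "vec A x = pind_incl \<phi> A j \<circ> \<rho> h"
    using jh by (simp add: fun_eq_iff vec_rep_mult)
  then show ?thesis using lin_maps_comp[OF \<rho>_lin incl_lin W fd_P] jh by simp
qed

lemmas vec_in_P = lin_mapsD(1)[OF vec_lin]

text \<open>The new representative and the element of \<open>H\<close> in the definition of the
  action are exactly those that \<open>vec\<close> computes from
  \<open>g \<otimes> \<gamma> i\<close>.\<close>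

lemma rep_gen_vec:
  assumes "(A, i) \<in> I" "g \<in> carrier G"
  shows "pind_rep_gen G H r \<gamma> \<rho> \<phi> g A i =
    (if inv g \<in> A then vec (g <# A) (g \<otimes> \<gamma> i) else (\<lambda>_. 0))"
proof
  fix w
  have "inv g <# H \<subseteq> A \<longleftrightarrow> inv g \<in> A"
    using l_coset_subset_coset_unions_iff[OF grp H, of A "inv g"] assms I_iff[of A i] by simp
  then show "pind_rep_gen G H r \<gamma> \<rho> \<phi> g A i w =
      (if inv g \<in> A then vec (g <# A) (g \<otimes> \<gamma> i) else (\<lambda>_. 0)) w"
    by (simp add: pind_rep_gen_def vec_def Let_def)
qed

lemma rep_gen_lin:
  assumes k: "(A, i) \<in> I" and g: "g \<in> carrier G"
  shows "pind_rep_gen G H r \<gamma> \<rho> \<phi> g A i \<in> lin_maps sW W sP P"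
proof (cases "inv g \<in> A")
  case True
  have A: "A \<in> CU" "\<gamma> i \<in> A" using k by (simp_all add: I_iff)
  have "g \<otimes> \<gamma> i \<in> g <# A" using A by (auto simp: l_coset_def)
  then show ?thesis
    unfolding rep_gen_vec[OF k g] using True vec_lin[OF CU_l_coset[OF A(1) g True]] by simp
next
  case False
  then show ?thesis using k g P.subspace_0[OF subspace_P]
    by (simp add: rep_gen_vec lin_maps_def zero_fun_def[symmetric])
qed

lemma \<rho>'_lin: "g \<in> carrier G \<Longrightarrow> \<rho>' g \<in> lin_maps sP P sP P"
  unfolding \<rho>'_eq_lift by (rule lift_lin[OF fd_P]) (rule rep_gen_lin)

text \<open>Writing \<open>x = \<gamma> j \<otimes> h\<close>, the factor \<open>h\<close> stays on
  the right of \<open>g \<otimes> \<gamma> j\<close> and is absorbed by \<open>vec_mult_H\<close>.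
  From here on the action is translation of labels.\<close>

lemma \<rho>'_vec:
  assumes A: "A \<in> CU" and x: "x \<in> A" and g: "g \<in> carrier G" and w: "w \<in> W"
  shows "\<rho>' g (vec A x w) = (if inv g \<in> A then vec (g <# A) (g \<otimes> x) w else 0)"
proof (rule CU_decomp[OF A x])
  fix j h assume jh: "(A, j) \<in> I" "j \<in> {1..r}" "h \<in> H" "x = \<gamma> j \<otimes> h"
  have "\<rho>' g (vec A x w) = pind_rep_gen G H r \<gamma> \<rho> \<phi> g A j (\<rho> h w)"
    unfolding \<rho>'_eq_lift using lift_incl[OF fd_P rep_gen_lin[OF _ g] jh(1)] jh w \<rho>_closed
    by (simp add: vec_rep_mult)
  then show ?thesis
    using jh g vec_mult_H[of "g \<otimes> \<gamma> j" h] \<gamma>_carrier H_carrier by (simp add: rep_gen_vec m_assoc)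
qed

lemma lin_maps_P_eqI_vec:
  assumes T: "fd_space sT T" and f: "f \<in> lin_maps sP P sT T" "f' \<in> lin_maps sP P sT T"
    and eq: "\<And>A x w. A \<in> CU \<Longrightarrow> x \<in> A \<Longrightarrow> w \<in> W \<Longrightarrow> f (vec A x w) = f' (vec A x w)"
  shows "f = f'"
proof (rule lin_maps_P_eqI[OF T f])
  fix A i w assume "(A, i) \<in> I" "w \<in> W"
  then show "f (pind_incl \<phi> A i w) = f' (pind_incl \<phi> A i w)"
    using eq[of A "\<gamma> i" w] vec_rep[of i w A] by (simp add: I_iff)
qed

subsection \<open>The induced partial representation\<close>

lemma \<rho>'_zero: "g \<in> carrier G \<Longrightarrow> \<rho>' g 0 = 0"
  by (rule zero_lin_map(2)[OF fd_P fd_P \<rho>'_lin])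

text \<open>Since \<open>inv g\<close> lies in \<open>h <# A\<close> exactly when
  \<open>inv (g \<otimes> h)\<close> lies in \<open>A\<close>, multiplicativity can fail only at the
  inner step. Both axioms of a partial representation follow from this.\<close>

lemma \<rho>'_\<rho>'_vec:
  assumes A: "A \<in> CU" and x: "x \<in> A" and g: "g \<in> carrier G" and h: "h \<in> carrier G" and w: "w \<in> W"
  shows "\<rho>' g (\<rho>' h (vec A x w)) = (if inv h \<in> A then \<rho>' (g \<otimes> h) (vec A x w) else 0)"
proof (cases "inv h \<in> A")
  case True
  have hA: "h <# A \<in> CU" "h \<otimes> x \<in> h <# A"
    using CU_l_coset[OF A h True] x by (auto simp: l_coset_def)
  have "inv g \<in> h <# A \<longleftrightarrow> inv (g \<otimes> h) \<in> A"
    using mem_l_coset_iff[OF CU_subset[OF A] h, of "inv g"] g h by (simp add: inv_mult_group)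
  then show ?thesis
    using True \<rho>'_vec[OF hA g w] \<rho>'_vec[OF A x h w] \<rho>'_vec[OF A x _ w, of "g \<otimes> h"] g h
      CU_subset[OF A] CU_carrier[OF A x]
    by (simp add: lcos_m_assoc m_assoc)
next
  case False
  then show ?thesis using \<rho>'_vec[OF A x h w] \<rho>'_zero[OF g] by simp
qed

lemma \<rho>'_one_vec:
  assumes "A \<in> CU" "x \<in> A" "w \<in> W"
  shows "\<rho>' \<one> (vec A x w) = vec A x w"
  using \<rho>'_vec[of A x \<one> w] assms CU_one CU_carrier[of A x] CU_subset
  by (simp add: lcos_mult_one)

lemma \<rho>'_one: "\<rho>' \<one> = id_map P"
proof (rule lin_maps_P_eqI_vec[OF fd_P \<rho>'_lin[OF one_closed]])
  show "id_map P \<in> lin_maps sP P sP P"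
    using P.subspace_add[OF subspace_P] P.subspace_scale[OF subspace_P]
    by (auto simp: lin_maps_def id_map_def)
  fix A x w assume "A \<in> CU" "x \<in> A" "w \<in> W"
  then show "\<rho>' \<one> (vec A x w) = id_map P (vec A x w)"
    by (simp add: \<rho>'_one_vec vec_in_P id_map_def)
qed

lemma \<rho>'_comp_lin:
  "g \<in> carrier G \<Longrightarrow> f \<in> lin_maps sP P sP P \<Longrightarrow> \<rho>' g \<circ> f \<in> lin_maps sP P sP P"
  using lin_maps_comp[OF _ \<rho>'_lin fd_P fd_P] by blast

lemma partial_rep_P: "partial_rep G sP P \<rho>'"
  unfolding partial_rep_def
proof (intro conjI ballI)
  fix g h assume g: "g \<in> carrier G" and h: "h \<in> carrier G"
  show "\<rho>' (inv g) \<circ> \<rho>' (g \<otimes> h) = \<rho>' (inv g) \<circ> \<rho>' g \<circ> \<rho>' h"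
  proof (rule lin_maps_P_eqI_vec[OF fd_P])
    fix A x w assume v: "A \<in> CU" "x \<in> A" "w \<in> W"
    \<comment> \<open>If \<open>inv h\<close> is not in \<open>A\<close>, the right side vanishes,
      while the left side is 0 or collapses to \<open>\<rho>' h\<close> of the vector.\<close>
    have "\<rho>' h (vec A x w) = 0" if "inv h \<notin> A" using that \<rho>'_vec[OF v(1,2) h v(3)] by simp
    then show "(\<rho>' (inv g) \<circ> \<rho>' (g \<otimes> h)) (vec A x w) = (\<rho>' (inv g) \<circ> \<rho>' g \<circ> \<rho>' h) (vec A x w)"
      using \<rho>'_\<rho>'_vec[OF v(1,2) _ _ v(3), of "inv g" "g \<otimes> h"]
        \<rho>'_\<rho>'_vec[OF v(1,2) g h v(3)] \<rho>'_zero[of "inv g"] g h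
      by (simp add: m_assoc[symmetric])
  qed (use g h in \<open>simp_all add: \<rho>'_comp_lin \<rho>'_lin comp_assoc\<close>)
  show "\<rho>' (g \<otimes> h) \<circ> \<rho>' (inv h) = \<rho>' g \<circ> \<rho>' h \<circ> \<rho>' (inv h)"
  proof (rule lin_maps_P_eqI_vec[OF fd_P])
    fix A x w assume v: "A \<in> CU" "x \<in> A" "w \<in> W"
    show "(\<rho>' (g \<otimes> h) \<circ> \<rho>' (inv h)) (vec A x w) = (\<rho>' g \<circ> \<rho>' h \<circ> \<rho>' (inv h)) (vec A x w)"
      using \<rho>'_\<rho>'_vec[OF v(1,2) _ _ v(3), of "g \<otimes> h" "inv h"]
        \<rho>'_\<rho>'_vec[OF v(1,2) h _ v(3), of "inv h"] \<rho>'_one_vec[OF v] \<rho>'_zero[OF g] g h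
      by (simp add: m_assoc)
  qed (use g h in \<open>simp_all add: \<rho>'_comp_lin \<rho>'_lin comp_assoc\<close>)
qed (simp_all add: fd_P \<rho>'_lin \<rho>'_one)

text \<open>Every coset union contains \<open>H\<close>, hence \<open>inv h\<close>, so the
  vanishing case never occurs for \<open>h\<close> in \<open>H\<close>.\<close>

lemma global_partial_rep_P: "global_partial_rep G H sP P \<rho>'"
proof -
  have "\<rho>' (g \<otimes> h) = \<rho>' g \<circ> \<rho>' h" if g: "g \<in> H" and h: "h \<in> H" for g h
  proof (rule lin_maps_P_eqI_vec[OF fd_P])
    fix A x w assume v: "A \<in> CU" "x \<in> A" "w \<in> W"
    show "\<rho>' (g \<otimes> h) (vec A x w) = (\<rho>' g \<circ> \<rho>' h) (vec A x w)"
      using \<rho>'_\<rho>'_vec[OF v(1,2) H_carrier[OF g] H_carrier[OF h] v(3)]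
        CU_H[OF v(1) subgroup.m_inv_closed[OF H h]] by simp
  qed (use g h H_carrier in \<open>simp_all add: \<rho>'_comp_lin \<rho>'_lin\<close>)
  then show ?thesis
    using partial_rep_P fd_P \<rho>'_lin H_carrier \<rho>'_one
    by (simp add: global_partial_rep_def representation_def)
qed

section \<open>The unit map and its equivariance\<close>

lemma CU_one_index: "A \<in> CU \<Longrightarrow> (A, 1) \<in> I"
  unfolding I_iff using one_index CU_one by (simp only: \<gamma>_one)

lemma \<eta>_eq: "w \<in> W \<Longrightarrow> \<eta> w = (\<Sum>A\<in>CU. vec A \<one> w)"
  unfolding pind_unit_def
  by (rule sum.cong[OF refl]) (metis vec_rep[OF one_index] \<gamma>_one)

lemma \<eta>_lin: "\<eta> \<in> lin_maps sW W sP P"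
  unfolding lin_maps_def
proof (intro CollectI conjI ballI allI impI)
  show "\<eta> w \<in> P" if "w \<in> W" for w
    unfolding pind_unit_def
    using that by (intro P.subspace_sum[OF subspace_P] incl_in_P CU_one_index)
  show "\<eta> (v + w) = \<eta> v + \<eta> w" if "v \<in> W" "w \<in> W" for v w
    unfolding pind_unit_def sum.distrib[symmetric]
    using that by (intro sum.cong[OF refl] lin_mapsD(2)[OF incl_lin[OF CU_one_index]])
  show "\<eta> (sW c w) = sP c (\<eta> w)" if "w \<in> W" for c w
    unfolding pind_unit_def P.scale_sum_right
    using that by (intro sum.cong[OF refl] lin_mapsD(3)[OF incl_lin[OF CU_one_index]])
  show "\<eta> w = 0" if "w \<notin> W" for w
    unfolding pind_unit_def
    using that by (intro sum.neutral ballI lin_mapsD(4)[OF incl_lin[OF CU_one_index]])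
qed

text \<open>Left translation by \<open>h\<close> permutes the coset unions, and
  \<open>\<rho>' h\<close> sends \<open>vec A \<one> w\<close> to \<open>vec (h <# A) h w\<close>,
  which is \<open>vec (h <# A) \<one> (\<rho> h w)\<close>.\<close>

lemma \<eta>_hom: "\<eta> \<in> rep_hom H sW W \<rho> sP P \<rho>'"
  unfolding rep_hom_def
proof (intro CollectI conjI ballI \<eta>_lin)
  fix h assume h: "h \<in> H"
  note hG = H_carrier[OF h]
  show "\<eta> \<circ> \<rho> h = \<rho>' h \<circ> \<eta>"
  proof (rule ext)
    fix w
    show "(\<eta> \<circ> \<rho> h) w = (\<rho>' h \<circ> \<eta>) w"
    proof (cases "w \<in> W")
      case True
      have CU_H_coset: "g <# A \<in> CU" if "g \<in> H" "A \<in> CU" for g A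
        using CU_l_coset[OF that(2) H_carrier[OF that(1)]] CU_H[OF that(2)]
          subgroup.m_inv_closed[OF H that(1)] by blast
      have bij: "bij_betw (\<lambda>A. h <# A) CU CU"
        using h hG CU_subset subgroup.m_inv_closed[OF H h]
        by (intro bij_betw_byWitness[where f' = "\<lambda>A. inv h <# A"] image_subsetI ballI CU_H_coset)
          (auto simp: lcos_m_assoc lcos_mult_one)
      have "\<eta> (\<rho> h w) = (\<Sum>A\<in>CU. vec A (\<one> \<otimes> h) w)"
        using True h \<rho>_closed by (simp add: \<eta>_eq vec_mult_H[OF one_closed h, symmetric] hG)
      also have "\<dots> = (\<Sum>A\<in>CU. vec (h <# A) h w)"
        using sum.reindex_bij_betw[OF bij, of "\<lambda>A. vec A h w"] hG by simp
      also have "\<dots> = (\<Sum>A\<in>CU. \<rho>' h (vec A \<one> w))"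
      proof (rule sum.cong[OF refl])
        fix A assume A: "A \<in> CU"
        then show "vec (h <# A) h w = \<rho>' h (vec A \<one> w)"
          using \<rho>'_vec[OF A CU_one[OF A] hG True] CU_H[OF A subgroup.m_inv_closed[OF H h]] hG
          by simp
      qed
      also have "\<dots> = \<rho>' h (\<eta> w)"
        unfolding \<eta>_eq[OF True]
        by (rule lin_map_sum[OF fd_P fd_P \<rho>'_lin[OF hG], symmetric]) (use True vec_in_P CU_one in blast)
      finally show ?thesis by simp
    next
      case False
      then have "\<rho> h w = 0" "\<eta> w = 0" using lin_mapsD(4)[OF \<rho>_lin[OF h]] lin_mapsD(4)[OF \<eta>_lin] by auto
      then show ?thesis using \<rho>'_zero[OF hG] zero_lin_map(2)[OF W fd_P \<eta>_lin] by simp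
    qed
  qed
qed

lemma vec_eq_\<rho>'_vec_one:
  assumes A: "A \<in> CU" and x: "x \<in> A" and w: "w \<in> W"
  shows "inv x <# A \<in> CU" and "vec A x w = \<rho>' x (vec (inv x <# A) \<one> w)"
proof -
  have xG: "x \<in> carrier G" using CU_carrier A x .
  show A': "inv x <# A \<in> CU" using CU_l_coset[OF A, of "inv x"] x xG by simp
  have "inv x \<in> inv x <# A" using mem_l_coset_iff[OF CU_subset[OF A]] xG CU_one[OF A] by simp
  then show "vec A x w = \<rho>' x (vec (inv x <# A) \<one> w)"
    using \<rho>'_vec[OF A' CU_one[OF A'] xG w] xG CU_subset[OF A] by (simp add: lcos_m_assoc lcos_mult_one)
qed

subsection \<open>The universal property\<close>

context
  fixes sU :: "complex \<Rightarrow> 'u::ab_group_add \<Rightarrow> 'u" and U :: "'u set" and \<tau> :: "'g \<Rightarrow> 'u \<Rightarrow> 'u"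
  assumes \<tau>: "global_partial_rep G H sU U \<tau>"
begin

interpretation R: global_partial_rep_space G H sU U \<tau>
  by (rule global_partial_rep_space.intro[OF grp finite_G H \<tau>])

definition extension :: "('w \<Rightarrow> 'u) \<Rightarrow> ('g set \<times> nat \<Rightarrow> 'x) \<Rightarrow> 'u" where
  "extension f = lift (\<lambda>A i w. \<tau> (\<gamma> i) (R.component (inv (\<gamma> i) <# A) (f w)))"

context
  fixes f :: "'w \<Rightarrow> 'u"
  assumes f: "f \<in> rep_hom H sW W \<rho> sU U \<tau>"
begin

lemma f_lin: "f \<in> lin_maps sW W sU U"
  using f by (simp add: rep_hom_def)

lemmas f_closed = lin_mapsD(1)[OF f_lin]

lemma f_\<rho>: "h \<in> H \<Longrightarrow> f (\<rho> h w) = \<tau> h (f w)"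
  using f by (simp add: rep_hom_def fun_eq_iff)

lemma extension_summand_lin:
  assumes "(A, i) \<in> I"
  shows "(\<lambda>w. \<tau> (\<gamma> i) (R.component (inv (\<gamma> i) <# A) (f w))) \<in> lin_maps sW W sU U"
proof -
  have "\<gamma> i \<in> carrier G" using assms \<gamma>_carrier by (simp add: I_iff)
  then show ?thesis
    using lin_mapsD[OF f_lin]
    by (simp add: lin_maps_def R.\<tau>_closed R.\<tau>_add R.\<tau>_scale R.\<tau>_zero R.component_closed
        R.component_add R.component_scale R.component_zero)
qed

lemma extension_lin: "extension f \<in> lin_maps sP P sU U"
  unfolding extension_def by (rule lift_lin[OF R.U extension_summand_lin])

text \<open>The formula defining \<open>extension\<close> survives the passage from
  \<open>\<gamma> j\<close> to \<open>x = \<gamma> j \<otimes> h\<close>: \<open>f\<close> turns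
  \<open>\<rho> h\<close> into \<open>\<tau> h\<close>, which moves the component at
  \<open>inv x <# A\<close> to the one at \<open>inv (\<gamma> j) <# A\<close>.\<close>

lemma extension_vec:
  assumes A: "A \<in> CU" and x: "x \<in> A" and w: "w \<in> W"
  shows "extension f (vec A x w) = \<tau> x (R.component (inv x <# A) (f w))"
proof (rule CU_decomp[OF A x])
  fix j h assume jh: "(A, j) \<in> I" "j \<in> {1..r}" "h \<in> H" "x = \<gamma> j \<otimes> h"
  have c: "\<gamma> j \<in> carrier G" "h \<in> carrier G" using jh \<gamma>_carrier H_carrier by blast+
  have sub: "inv x <# A \<subseteq> carrier G"
    using l_coset_subset_G[OF CU_subset[OF A]] CU_carrier[OF A x] by simp
  have coset: "h <# (inv x <# A) = inv (\<gamma> j) <# A"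
    using c CU_subset[OF A] by (simp add: jh(4) lcos_m_assoc inv_mult_group m_assoc[symmetric])
  have "extension f (vec A x w) = \<tau> (\<gamma> j) (R.component (inv (\<gamma> j) <# A) (f (\<rho> h w)))"
    unfolding extension_def jh(4) vec_rep_mult[OF jh(2,3)]
    by (rule lift_incl[OF R.U extension_summand_lin jh(1) \<rho>_closed[OF jh(3) w]])
  also have "\<dots> = \<tau> (\<gamma> j) (\<tau> h (R.component (inv x <# A) (f w)))"
    using R.\<tau>_component[OF f_closed[OF w] jh(3) sub] by (simp add: coset f_\<rho>[OF jh(3)])
  finally show ?thesis using R.\<tau>_mult_H[OF c(1) jh(3)] jh(4) by simp
qed

text \<open>As \<open>\<one>\<close> is in \<open>A\<close>, \<open>inv x\<close> is in
  \<open>inv x <# A\<close>, so \<open>\<tau> g (\<tau> x ?v) = \<tau> (g \<otimes> x) ?v\<close>.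
  If \<open>inv g\<close> is in \<open>A\<close>, translating both labels by \<open>g\<close> leaves
  \<open>inv x <# A\<close> unchanged; otherwise both sides vanish.\<close>

lemma extension_hom: "extension f \<in> rep_hom (carrier G) sP P \<rho>' sU U \<tau>"
  unfolding rep_hom_def
proof (intro CollectI conjI ballI extension_lin)
  fix g assume g: "g \<in> carrier G"
  show "extension f \<circ> \<rho>' g = \<tau> g \<circ> extension f"
  proof (rule lin_maps_P_eqI_vec[OF R.U])
    show "extension f \<circ> \<rho>' g \<in> lin_maps sP P sU U"
      by (rule lin_maps_comp[OF \<rho>'_lin[OF g] extension_lin fd_P R.U])
    show "\<tau> g \<circ> extension f \<in> lin_maps sP P sU U"
      by (rule lin_maps_comp[OF extension_lin R.\<tau>_lin[OF g] R.U R.U])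
    fix A x w assume A: "A \<in> CU" and x: "x \<in> A" and w: "w \<in> W"
    have xG: "x \<in> carrier G" and AG: "A \<subseteq> carrier G" using CU_carrier CU_subset A x by blast+
    let ?v = "R.component (inv x <# A) (f w)"
    have v: "?v \<in> R.eigen (inv x <# A)" using R.component_in_eigen[OF f_closed[OF w]] .
    have "inv x \<in> inv x <# A"
      using mem_l_coset_iff[OF AG] xG CU_one[OF A] by simp
    then have rhs: "\<tau> g (\<tau> x ?v) = \<tau> (g \<otimes> x) ?v"
      using R.\<tau>_mult_eigen[OF v xG] g by blast
    have mem: "inv (g \<otimes> x) \<in> inv x <# A \<longleftrightarrow> inv g \<in> A"
      using mem_l_coset_iff[OF AG, of "inv x" "inv (g \<otimes> x)"] xG g
      by (simp add: inv_mult_group m_assoc[symmetric])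
    show "(extension f \<circ> \<rho>' g) (vec A x w) = (\<tau> g \<circ> extension f) (vec A x w)"
    proof (cases "inv g \<in> A")
      case True
      have gx: "g \<otimes> x \<in> g <# A" using x by (auto simp: l_coset_def)
      have "inv (g \<otimes> x) <# (g <# A) = inv x <# A"
        using xG g AG by (simp add: lcos_m_assoc inv_mult_group m_assoc)
      then show ?thesis
        using \<rho>'_vec[OF A x g w] True extension_vec[OF CU_l_coset[OF A g True] gx w] rhs
          extension_vec[OF A x w] by simp
    next
      case False
      then have "\<tau> (g \<otimes> x) ?v = 0"
        using R.\<tau>_eigen_eq_0[OF v, of "g \<otimes> x"] mem xG g by simp
      then show ?thesis
        using \<rho>'_vec[OF A x g w] False rhs extension_vec[OF A x w]
          zero_lin_map(2)[OF fd_P R.U extension_lin] by simp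
    qed
  qed
qed

text \<open>At \<open>x = \<one>\<close> the extension returns the component of \<open>f w\<close>
  at \<open>A\<close>, and these components sum to \<open>f w\<close>.\<close>

lemma extension_\<eta>: "extension f \<circ> \<eta> = f"
proof
  fix w
  show "(extension f \<circ> \<eta>) w = f w"
  proof (cases "w \<in> W")
    case True
    have "extension f (\<eta> w) = (\<Sum>A\<in>CU. extension f (vec A \<one> w))"
      unfolding \<eta>_eq[OF True]
      by (rule lin_map_sum[OF fd_P R.U extension_lin]) (use True vec_in_P CU_one in blast)
    also have "\<dots> = (\<Sum>A\<in>CU. R.component A (f w))"
    proof (rule sum.cong[OF refl])
      fix A assume A: "A \<in> CU"
      show "extension f (vec A \<one> w) = R.component A (f w)"
        using extension_vec[OF A CU_one[OF A] True] CU_subset[OF A]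
          R.component_closed[OF f_closed[OF True]]
        by (simp add: lcos_mult_one R.\<tau>_one id_map_def)
    qed
    also have "\<dots> = f w" by (rule R.component_sum_coset_unions[OF f_closed[OF True]])
    finally show ?thesis by simp
  next
    case False
    then show ?thesis
      using lin_mapsD(4)[OF \<eta>_lin] lin_mapsD(4)[OF f_lin] zero_lin_map(2)[OF fd_P R.U extension_lin]
      by simp
  qed
qed

lemma extension_unique:
  assumes F: "F \<in> rep_hom (carrier G) sP P \<rho>' sU U \<tau>" and F\<eta>: "F \<circ> \<eta> = f"
  shows "F = extension f"
proof (rule lin_maps_P_eqI_vec[OF R.U _ extension_lin])
  show F_lin: "F \<in> lin_maps sP P sU U" using F by (simp add: rep_hom_def)
  have F_\<rho>': "F (\<rho>' g x) = \<tau> g (F x)" if "g \<in> carrier G" for g x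
    using F that by (simp add: rep_hom_def fun_eq_iff)
  have F_one: "F (vec A \<one> w) = R.component A (f w)" if A: "A \<in> CU" and w: "w \<in> W" for A w
  proof -
    \<comment> \<open>The vector \<open>vec B \<one> w\<close> is an eigenvector for the idempotents
      of \<open>\<rho>'\<close>, and \<open>F\<close> intertwines them with
      \<open>\<epsilon>\<close>. The images therefore form the eigenvector decomposition of
      \<open>f w\<close>.\<close>
    have eigen: "F (vec B \<one> w) \<in> R.eigen B" if B: "B \<in> CU" for B
      unfolding R.eigen_def
    proof (intro CollectI conjI ballI)
      note v = B CU_one[OF B]
      show "F (vec B \<one> w) \<in> U" using lin_mapsD(1)[OF F_lin vec_in_P[OF v w]] .
      fix g assume g: "g \<in> carrier G"
      have "R.\<epsilon> g (F (vec B \<one> w)) = F (\<rho>' g (\<rho>' (inv g) (vec B \<one> w)))"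
        using g by (simp add: R.\<epsilon>_def F_\<rho>')
      then show "R.\<epsilon> g (F (vec B \<one> w)) = (if g \<in> B then F (vec B \<one> w) else 0)"
        using \<rho>'_\<rho>'_vec[OF v g _ w, of "inv g"] g \<rho>'_one_vec[OF v w]
          zero_lin_map(2)[OF fd_P R.U F_lin] by simp
    qed
    have "f w = F (\<eta> w)" using F\<eta> by auto
    also have "\<dots> = (\<Sum>B\<in>CU. F (vec B \<one> w))"
      unfolding \<eta>_eq[OF w]
      by (rule lin_map_sum[OF fd_P R.U F_lin]) (use w vec_in_P CU_one in blast)
    finally have sum: "f w = (\<Sum>B\<in>CU. F (vec B \<one> w))" .
    have "CU \<subseteq> Pow (carrier G)" using CU_subset by blast
    from R.component_unique[OF this eigen A] show ?thesis unfolding sum ..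
  qed
  fix A x w assume A: "A \<in> CU" and x: "x \<in> A" and w: "w \<in> W"
  have "F (vec A x w) = \<tau> x (F (vec (inv x <# A) \<one> w))"
    unfolding vec_eq_\<rho>'_vec_one(2)[OF A x w] by (rule F_\<rho>'[OF CU_carrier[OF A x]])
  then show "F (vec A x w) = extension f (vec A x w)"
    unfolding extension_vec[OF A x w] F_one[OF vec_eq_\<rho>'_vec_one(1)[OF A x w] w] .
qed

end

section \<open>Frobenius reciprocity\<close>

lemma comp_\<eta>_hom:
  assumes F: "F \<in> rep_hom (carrier G) sP P \<rho>' sU U \<tau>"
  shows "F \<circ> \<eta> \<in> rep_hom H sW W \<rho> sU U \<tau>"
  unfolding rep_hom_def
proof (intro CollectI conjI ballI)
  show "F \<circ> \<eta> \<in> lin_maps sW W sU U"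
    using F lin_maps_comp[OF \<eta>_lin _ fd_P R.U] by (simp add: rep_hom_def)
  fix h assume h: "h \<in> H"
  have "F \<circ> \<eta> \<circ> \<rho> h = F \<circ> \<rho>' h \<circ> \<eta>" using \<eta>_hom h by (simp add: rep_hom_def comp_assoc)
  also have "\<dots> = \<tau> h \<circ> F \<circ> \<eta>" using F H_carrier[OF h] by (simp add: rep_hom_def)
  finally show "F \<circ> \<eta> \<circ> \<rho> h = \<tau> h \<circ> (F \<circ> \<eta>)" by (simp add: comp_assoc)
qed

lemma universal_property:
  assumes "f \<in> rep_hom H sW W \<rho> sU U \<tau>"
  shows "\<exists>!F. F \<in> rep_hom (carrier G) sP P \<rho>' sU U \<tau> \<and> F \<circ> \<eta> = f"
  using extension_hom[OF assms] extension_\<eta>[OF assms] extension_unique[OF assms] by blast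

lemma frobenius_reciprocity:
  "\<exists>\<Phi> \<in> lin_isos (fun_scale sU) (rep_hom (carrier G) sP P \<rho>' sU U \<tau>)
                  (fun_scale sU) (rep_hom H sW W \<rho> sU U \<tau>).
     \<forall>F \<in> rep_hom (carrier G) sP P \<rho>' sU U \<tau>. \<Phi> F = F \<circ> \<eta>"
proof -
  let ?M = "rep_hom (carrier G) sP P \<rho>' sU U \<tau>" and ?N = "rep_hom H sW W \<rho> sU U \<tau>"
  \<comment> \<open>The value 0 outside the Hom space is forced by the convention in
    \<open>lin_maps\<close>.\<close>
  define \<Phi> where "\<Phi> F = (if F \<in> ?M then F \<circ> \<eta> else 0)" for F
  have M: "F \<in> ?M \<longleftrightarrow> F \<in> lin_maps sP P sU U \<and> (\<forall>g\<in>carrier G. \<forall>x. F (\<rho>' g x) = \<tau> g (F x))" for F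
    by (simp add: rep_hom_def fun_eq_iff)
  have lin: "F \<in> lin_maps sP P sU U" if "F \<in> ?M" for F
    using that unfolding M by blast
  \<comment> \<open>Also for \<open>x\<close> outside \<open>P\<close>, where
    \<open>F x = 0\<close>; intertwining is required at all arguments, and \<open>\<tau>\<close> is
    linear only on \<open>U\<close>.\<close>
  have F_in_U: "F x \<in> U" if "F \<in> ?M" for F x
    using lin_mapsD(1,4)[OF lin[OF that]] R.U_closed(1) by (cases "x \<in> P") simp_all
  \<comment> \<open>Because \<open>\<Phi>\<close> is defined by cases, its linearity presupposes
    that the Hom space is closed under sums and multiples.\<close>
  have add: "F + F' \<in> ?M" if F: "F \<in> ?M" "F' \<in> ?M" for F F'
    unfolding M
  proof (intro conjI ballI allI)
    show "F + F' \<in> lin_maps sP P sU U"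
      unfolding lin_maps_def
    proof (intro CollectI conjI ballI allI impI)
      show "(F + F') x \<in> U" for x using F F_in_U R.U_closed(2) by simp
      show "(F + F') (x + y) = (F + F') x + (F + F') y" if "x \<in> P" "y \<in> P" for x y
        using lin_mapsD(2)[OF lin[OF F(1)] that] lin_mapsD(2)[OF lin[OF F(2)] that]
        by (simp add: plus_fun_def)
      show "(F + F') (sP c x) = sU c ((F + F') x)" if "x \<in> P" for c x
        using lin_mapsD(3)[OF lin[OF F(1)] that] lin_mapsD(3)[OF lin[OF F(2)] that]
        by (simp add: R.U.scale_right_distrib)
      show "(F + F') x = 0" if "x \<notin> P" for x
        using lin_mapsD(4)[OF lin[OF F(1)] that] lin_mapsD(4)[OF lin[OF F(2)] that] by simp
    qed
    show "(F + F') (\<rho>' g x) = \<tau> g ((F + F') x)" if g: "g \<in> carrier G" for g x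
    proof -
      have "F (\<rho>' g x) = \<tau> g (F x)" "F' (\<rho>' g x) = \<tau> g (F' x)" using F g unfolding M by blast+
      then show ?thesis using R.\<tau>_add[OF g F_in_U F_in_U] F by simp
    qed
  qed
  have scale: "fun_scale sU c F \<in> ?M" if F: "F \<in> ?M" for c F
    unfolding M
  proof (intro conjI ballI allI)
    show "fun_scale sU c F \<in> lin_maps sP P sU U"
      unfolding lin_maps_def
    proof (intro CollectI conjI ballI allI impI)
      show "fun_scale sU c F x \<in> U" for x
        using F F_in_U R.U_closed(4) by (simp add: fun_scale_def)
      show "fun_scale sU c F (x + y) = fun_scale sU c F x + fun_scale sU c F y"
        if "x \<in> P" "y \<in> P" for x y
        unfolding fun_scale_def[of sU] lin_mapsD(2)[OF lin[OF F] that]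
        by (rule R.U.scale_right_distrib)
      show "fun_scale sU c F (sP d x) = sU d (fun_scale sU c F x)" if "x \<in> P" for d x
        unfolding fun_scale_def[of sU] lin_mapsD(3)[OF lin[OF F] that]
        by (rule R.U.scale_left_commute)
      show "fun_scale sU c F x = 0" if "x \<notin> P" for x
        using lin_mapsD(4)[OF lin[OF F] that] by (simp add: fun_scale_def)
    qed
    show "fun_scale sU c F (\<rho>' g x) = \<tau> g (fun_scale sU c F x)" if g: "g \<in> carrier G" for g x
    proof -
      have "F (\<rho>' g x) = \<tau> g (F x)" using F g unfolding M by blast
      then show ?thesis using R.\<tau>_scale[OF g F_in_U[OF F]] by (simp add: fun_scale_def)
    qed
  qed
  have "\<Phi> \<in> lin_maps (fun_scale sU) ?M (fun_scale sU) ?N"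
    unfolding lin_maps_def
  proof (intro CollectI conjI ballI allI impI)
    show "\<Phi> F \<in> ?N" if "F \<in> ?M" for F
      using that comp_\<eta>_hom by (simp add: \<Phi>_def)
    show "\<Phi> (F + F') = \<Phi> F + \<Phi> F'" if "F \<in> ?M" "F' \<in> ?M" for F F'
      using that add[OF that] by (simp add: \<Phi>_def fun_eq_iff)
    show "\<Phi> (fun_scale sU c F) = fun_scale sU c (\<Phi> F)" if "F \<in> ?M" for c F
      using that scale[OF that] by (simp add: \<Phi>_def fun_eq_iff fun_scale_def)
    show "\<Phi> F = 0" if "F \<notin> ?M" for F
      using that by (simp add: \<Phi>_def)
  qed
  moreover have "bij_betw \<Phi> ?M ?N"
  proof (rule bij_betw_byWitness[where f' = extension])
    show "\<forall>F\<in>?M. extension (\<Phi> F) = F"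
      using extension_unique[OF comp_\<eta>_hom _ refl] by (simp add: \<Phi>_def)
    show "\<forall>f\<in>?N. \<Phi> (extension f) = f"
      using extension_hom extension_\<eta> by (simp add: \<Phi>_def)
    show "\<Phi> ` ?M \<subseteq> ?N" using comp_\<eta>_hom by (auto simp: \<Phi>_def)
    show "extension ` ?N \<subseteq> ?M" using extension_hom by blast
  qed
  ultimately show ?thesis
    by (intro bexI[of _ \<Phi>]) (simp_all add: lin_isos_def \<Phi>_def)
qed

end

end

theorem mainTheorem8:
  fixes G :: "('g, 'm) monoid_scheme" and H :: "'g set"
    and r :: nat and \<gamma> :: "nat \<Rightarrow> 'g"
    and sW :: "complex \<Rightarrow> 'w::ab_group_add \<Rightarrow> 'w" and W :: "'w set" and \<rho> :: "'g \<Rightarrow> 'w \<Rightarrow> 'w"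
    and sX :: "complex \<Rightarrow> 'x::ab_group_add \<Rightarrow> 'x" and S :: "'g set \<Rightarrow> nat \<Rightarrow> 'x set"
    and \<phi> :: "'g set \<Rightarrow> nat \<Rightarrow> 'w \<Rightarrow> 'x"
  assumes "group G" and "finite (carrier G)" and "subgroup H G"
    and "coset_reps G H r \<gamma>"
    and "representation (G\<lparr>carrier := H\<rparr>) sW W \<rho>"
    and "\<And>A i. (A, i) \<in> pind_index G H r \<gamma> \<Longrightarrow> fd_space sX (S A i)"
    and "\<And>A i. (A, i) \<in> pind_index G H r \<gamma> \<Longrightarrow> \<phi> A i \<in> lin_isos sW W sX (S A i)"
  defines "P \<equiv> pind_space G H r \<gamma> S"
    and "sP \<equiv> fun_scale sX"
    and "\<rho>' \<equiv> pind_rep G H r \<gamma> W \<rho> S \<phi>"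
    and "\<eta> \<equiv> pind_unit G H \<phi>"
  shows "global_partial_rep G H sP P \<rho>' \<and>
    \<eta> \<in> rep_hom H sW W \<rho> sP P \<rho>' \<and>
    (\<forall>(sU :: complex \<Rightarrow> 'u::ab_group_add \<Rightarrow> 'u) (U :: 'u set) \<tau>.
       global_partial_rep G H sU U \<tau> \<longrightarrow>
         (\<forall>f \<in> rep_hom H sW W \<rho> sU U \<tau>.
            \<exists>!F. F \<in> rep_hom (carrier G) sP P \<rho>' sU U \<tau> \<and> F \<circ> \<eta> = f) \<and>
         (\<exists>\<Phi> \<in> lin_isos (fun_scale sU) (rep_hom (carrier G) sP P \<rho>' sU U \<tau>)
                        (fun_scale sU) (rep_hom H sW W \<rho> sU U \<tau>).
            \<forall>F \<in> rep_hom (carrier G) sP P \<rho>' sU U \<tau>. \<Phi> F = F \<circ> \<eta>))"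
proof (intro conjI allI impI ballI)
  interpret partial_induction G H r \<gamma> sW W \<rho> sX S \<phi>
    using assms(1-7) by (simp add: partial_induction_def)
  show "global_partial_rep G H sP P \<rho>'"
    unfolding assms(8-11) by (rule global_partial_rep_P)
  show "\<eta> \<in> rep_hom H sW W \<rho> sP P \<rho>'"
    unfolding assms(8-11) by (rule \<eta>_hom)
  fix sU :: "complex \<Rightarrow> 'u::ab_group_add \<Rightarrow> 'u" and U :: "'u set" and \<tau>
  assume \<tau>: "global_partial_rep G H sU U \<tau>"
  show "\<exists>!F. F \<in> rep_hom (carrier G) sP P \<rho>' sU U \<tau> \<and> F \<circ> \<eta> = f"
    if "f \<in> rep_hom H sW W \<rho> sU U \<tau>" for f
    using universal_property[OF \<tau> that] unfolding assms(8-11) .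
  show "\<exists>\<Phi> \<in> lin_isos (fun_scale sU) (rep_hom (carrier G) sP P \<rho>' sU U \<tau>)
                      (fun_scale sU) (rep_hom H sW W \<rho> sU U \<tau>).
          \<forall>F \<in> rep_hom (carrier G) sP P \<rho>' sU U \<tau>. \<Phi> F = F \<circ> \<eta>"
    using frobenius_reciprocity[OF \<tau>] unfolding assms(8-11) .
qed

end
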